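(* Let $\Sigma$ be a $\Sigma$-protocol with special soundness and unique responses for a relation $R$, and consider its Fischlin transform with parameters $k,l$ in the quantum random oracle model. Let $\mathcal P$ be a dishonest prover that outputs a pair $(x,\pi)$ and makes at most $q$ quantum queries to the random oracle. Let $\mathcal E$ denote the extractor below, and write $\langle\mathcal P,\mathcal E\rangle$ for the execution in which $\mathcal E$ simulates the oracle for $\mathcal P$ and for the verifier and outputs $w$. Then \[\Pr_{(x,\pi,w)\leftarrow\langle\mathcal P,\mathcal E\rangle}[\mathcal V(x,\pi)=1]=\Pr_{(x,\pi)\leftarrow\mathcal P^{H}}[\mathcal V(x,\pi)=1],\] where on the right $H$ is a uniformly random function, and \[\Pr_{(x,\pi,w)\leftarrow\langle\mathcal P,\mathcal E\rangle}[\mathcal V(x,\pi)=1\wedge (x,w)\notin R]\le 4(q+k)^{2}\cdot\delta,\] where $\delta\ge0$ is any number such that for every prover $\mathcal P'$ and every $\mathbf a_0\in\mathcal M^{k}$, \[\Pr_{(x,\pi=(\mathbf a,\mathbf c,\mathbf z),w)\leftarrow\langle\mathcal P',\mathcal E\rangle}[\mathbf a=\mathbf a_0\wedge\mathcal V(x,\pi)=1\wedge(x,w)\notin R]\le\delta.\]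
   Context: A $\Sigma$-protocol for $R\subseteq\mathcal X\times\mathcal W$: prover $(\mathcal P_1,\mathcal P_2)$, verifier $\mathcal V_\Sigma$, commitments $a\in\mathcal M$, uniformly random challenges $c\in\mathcal C$ ($|\mathcal C|=N$), responses $z\in\mathcal Z$, verdict $\mathcal V_\Sigma(x,a,c,z)\in\{0,1\}$; completeness holds. Special soundness: a PPT $\mathsf{Ext}_{ss}$ outputs a witness for $x$ from any two accepting transcripts $(a,c,z),(a,c',z')$ with $c\neq c'$. Unique responses: for all $x,a,c$ and $z\ne z'$, not both $(a,c,z)$ and $(a,c,z')$ are accepted. Fischlin transform: random oracle $H:\mathcal M^k\times[k]\times\mathcal C\times\mathcal Z\to\{0,1\}^l$; a proof is $\pi=(\mathbf a,\mathbf c,\mathbf z)$ with $\mathbf a=(a_i)_{i\in[k]}$ etc.; the verifier $\mathcal V(x,\pi)$ accepts iff for all $i\in[k]$, $H(\mathbf a,i,c_i,z_i)=0^l$ and $\mathcal V_\Sigma(x,a_i,c_i,z_i)=1$. Quantum queries: $|u\rangle|y\rangle\mapsto|u\rangle|y\oplus H(u)\rangle$. Compressed oracle: for each domain point $u$ there is a register $D_u$ with state space $\mathbb C^{2^l}\oplus\mathbb C|\perp\rangle$, initialized to $|\perp\rangle$. With $|+^l\rangle=2^{-l/2}\sum_{y\in\{0,1\}^l}|y\rangle$, let $\mathrm{Comp}=|\perp\rangle\langle+^l|+|+^l\rangle\langle\perp|+(\mathbb 1-|+^l\rangle\langle+^l|-|\perp\rangle\langle\perp|)$. A query applies $\sum_u|u\rangle\langle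 u|_X\otimes\mathrm{Comp}_{D_u}\mathrm{CNOT}_{YD_u}\mathrm{Comp}_{D_u}$, where $\mathrm{CNOT}|y\rangle|y'\rangle=|y\oplus y'\rangle|y'\rangle$ and $\mathrm{CNOT}$ acts as identity on $|y\rangle|\perp\rangle$. Extractor $\mathcal E$: simulates the random oracle (for the prover and for the verification of the output proof) with a compressed oracle; after the prover outputs $\pi$, verifies it and aborts if verification fails; measures the whole database register in the computational basis; takes the lexicographically first pair of entries with inputs $(\mathbf a,i,c,z),(\mathbf a,i,c',z')$ (non-$\perp$ values) such that $(c,z)\ne(c',z')$ and $\mathcal V_\Sigma(x,a_i,c,z)=\mathcal V_\Sigma(x,a_i,c',z')=1$, aborting if none exists; outputs $\mathsf{Ext}_{ss}(x,a_i,c,c',z,z')$. *)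

theory Defs
  imports Complex_Main "HOL-Library.List_Lexorder" "HOL-Library.Product_Lexorder"
begin

text \<open>Oracle inputs (a, i, c, z) with a a k-tuple of commitments (list of length k)
  and i in [k] = {0..<k} (0-indexed).  Oracle outputs {0,1}^l are encoded as naturals
  below 2^l, with bitwise xor; 0^l is 0.  Database values: None = bottom.\<close>

definition hdom :: "nat \<Rightarrow> ('m list \<times> nat \<times> 'c \<times> 'z) set" where
  "hdom k = {(as, i, c, z). length as = k \<and> i < k}"

definition hvals :: "nat \<Rightarrow> nat set" where
  "hvals l = {0..<2 ^ l}"

definition dopts :: "nat \<Rightarrow> nat option set" where
  "dopts l = insert None (Some ` hvals l)"

text \<open>Matrix entries of Comp on a single database register (row a, column b).\<close>
definition comp_entry :: "nat \<Rightarrow> nat option \<Rightarrow> nat option \<Rightarrow> complex" where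
  "comp_entry l a b = (case (a, b) of
      (None, None) \<Rightarrow> 0
    | (None, Some _) \<Rightarrow> complex_of_real (1 / sqrt (2 ^ l))
    | (Some _, None) \<Rightarrow> complex_of_real (1 / sqrt (2 ^ l))
    | (Some y, Some y') \<Rightarrow> (if y = y' then 1 else 0) - complex_of_real (1 / 2 ^ l))"

fun cnot_val :: "nat \<Rightarrow> nat option \<Rightarrow> nat" where
  "cnot_val y None = y"
| "cnot_val y (Some v) = xor y v"

text \<open>Matrix entries of Comp_D CNOT_{YD} Comp_D on (Y, D_u).\<close>
definition query_entry :: "nat \<Rightarrow> nat \<times> nat option \<Rightarrow> nat \<times> nat option \<Rightarrow> complex" where
  "query_entry l out inp = (case (out, inp) of ((y', e2), (y, e)) \<Rightarrow>
     (\<Sum>e1\<in>dopts l. comp_entry l e2 e1 * comp_entry l e1 e * (if y' = cnot_val y e1 then 1 else 0)))"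

text \<open>Computational basis of the prover's register: workspace {0..<d}, query input
  register X, query output register Y.\<close>
definition pbasis :: "nat \<Rightarrow> nat \<Rightarrow> nat \<Rightarrow> (nat \<times> ('m list \<times> nat \<times> 'c \<times> 'z) \<times> nat) set" where
  "pbasis k l d = {0..<d} \<times> hdom k \<times> hvals l"

definition db_basis :: "nat \<Rightarrow> nat \<Rightarrow> (('m list \<times> nat \<times> 'c \<times> 'z) \<Rightarrow> nat option) set" where
  "db_basis k l = {D. \<forall>u. (u \<notin> hdom k \<longrightarrow> D u = None) \<and> (u \<in> hdom k \<longrightarrow> D u \<in> dopts l)}"

definition unitary_on :: "'b set \<Rightarrow> ('b \<Rightarrow> 'b \<Rightarrow> complex) \<Rightarrow> bool" where
  "unitary_on B U = (\<forall>a\<in>B. \<forall>b\<in>B. (\<Sum>c\<in>B. cnj (U c a) * U c b) = (if a = b then 1 else 0))"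

text \<open>A (dishonest, quantum) prover: workspace dimension d, initial normalized state psi0,
  unitaries U_0,...,U_m (with a quantum oracle query between consecutive ones, i.e. m
  queries), and a final computational-basis measurement followed by classical
  post-processing meas, producing (x, pi).\<close>
definition valid_prover :: "nat \<Rightarrow> nat \<Rightarrow> nat \<Rightarrow>
    (nat \<times> ('m list \<times> nat \<times> 'c \<times> 'z) \<times> nat \<Rightarrow> complex) \<Rightarrow>
    (nat \<times> ('m list \<times> nat \<times> 'c \<times> 'z) \<times> nat \<Rightarrow> nat \<times> ('m list \<times> nat \<times> 'c \<times> 'z) \<times> nat \<Rightarrow> complex) list
    \<Rightarrow> bool" where
  "valid_prover k l d psi0 Us =
     (Us \<noteq> [] \<and> (\<Sum>p\<in>pbasis k l d. (cmod (psi0 p))\<^sup>2) = 1 \<and>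
      (\<forall>U\<in>set Us. unitary_on (pbasis k l d) U))"

definition apply_U :: "'b set \<Rightarrow> ('b \<Rightarrow> 'b \<Rightarrow> complex) \<Rightarrow> ('b \<Rightarrow> complex) \<Rightarrow> 'b \<Rightarrow> complex" where
  "apply_U B U \<psi> = (\<lambda>a. \<Sum>b\<in>B. U a b * \<psi> b)"

definition squery :: "('u \<Rightarrow> nat) \<Rightarrow> (nat \<times> 'u \<times> nat \<Rightarrow> complex) \<Rightarrow> nat \<times> 'u \<times> nat \<Rightarrow> complex" where
  "squery H \<psi> = (\<lambda>(w, u, y). \<psi> (w, u, xor y (H u)))"

fun run_std :: "(nat \<times> 'u \<times> nat) set \<Rightarrow> ('u \<Rightarrow> nat) \<Rightarrow> ((nat \<times> 'u \<times> nat) \<Rightarrow> (nat \<times> 'u \<times> nat) \<Rightarrow> complex) list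
    \<Rightarrow> (nat \<times> 'u \<times> nat \<Rightarrow> complex) \<Rightarrow> nat \<times> 'u \<times> nat \<Rightarrow> complex" where
  "run_std B H [] \<psi> = \<psi>"
| "run_std B H [U] \<psi> = apply_U B U \<psi>"
| "run_std B H (U # U' # Us) \<psi> = run_std B H (U' # Us) (squery H (apply_U B U \<psi>))"

definition lift_U :: "'b set \<Rightarrow> ('b \<Rightarrow> 'b \<Rightarrow> complex) \<Rightarrow> ('b \<times> 'd \<Rightarrow> complex) \<Rightarrow> 'b \<times> 'd \<Rightarrow> complex" where
  "lift_U B U \<Psi> = (\<lambda>(a, D). \<Sum>b\<in>B. U a b * \<Psi> (b, D))"

definition cquery :: "nat \<Rightarrow> ((nat \<times> 'u \<times> nat) \<times> ('u \<Rightarrow> nat option) \<Rightarrow> complex)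
    \<Rightarrow> (nat \<times> 'u \<times> nat) \<times> ('u \<Rightarrow> nat option) \<Rightarrow> complex" where
  "cquery l \<Psi> = (\<lambda>((w, u, y'), D').
     \<Sum>y\<in>hvals l. \<Sum>e\<in>dopts l. query_entry l (y', D' u) (y, e) * \<Psi> ((w, u, y), D'(u := e)))"

fun run_comp :: "(nat \<times> 'u \<times> nat) set \<Rightarrow> nat \<Rightarrow> ((nat \<times> 'u \<times> nat) \<Rightarrow> (nat \<times> 'u \<times> nat) \<Rightarrow> complex) list
    \<Rightarrow> ((nat \<times> 'u \<times> nat) \<times> ('u \<Rightarrow> nat option) \<Rightarrow> complex)
    \<Rightarrow> (nat \<times> 'u \<times> nat) \<times> ('u \<Rightarrow> nat option) \<Rightarrow> complex" where
  "run_comp B l [] \<Psi> = \<Psi>"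
| "run_comp B l [U] \<Psi> = lift_U B U \<Psi>"
| "run_comp B l (U # U' # Us) \<Psi> = run_comp B l (U' # Us) (cquery l (lift_U B U \<Psi>))"

definition wf_proof :: "nat \<Rightarrow> 'm list \<times> 'c list \<times> 'z list \<Rightarrow> bool" where
  "wf_proof k \<pi> = (case \<pi> of (as, cs, zs) \<Rightarrow> length as = k \<and> length cs = k \<and> length zs = k)"

definition qpt :: "'m list \<times> 'c list \<times> 'z list \<Rightarrow> nat \<Rightarrow> 'm list \<times> nat \<times> 'c \<times> 'z" where
  "qpt \<pi> i = (case \<pi> of (as, cs, zs) \<Rightarrow> (as, i, cs ! i, zs ! i))"

definition fischlin_verify :: "nat \<Rightarrow> ('m list \<times> nat \<times> 'c \<times> 'z \<Rightarrow> nat) \<Rightarrow>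
    ('x \<Rightarrow> 'm \<Rightarrow> 'c \<Rightarrow> 'z \<Rightarrow> bool) \<Rightarrow> 'x \<Rightarrow> 'm list \<times> 'c list \<times> 'z list \<Rightarrow> bool" where
  "fischlin_verify k H V x \<pi> = (wf_proof k \<pi> \<and>
     (case \<pi> of (as, cs, zs) \<Rightarrow> (\<forall>i<k. H (as, i, cs ! i, zs ! i) = 0 \<and> V x (as ! i) (cs ! i) (zs ! i))))"

text \<open>Same verdict, given the oracle answers ys = (H(a,i,c_i,z_i))_i obtained by the extractor.\<close>
definition accept_ext :: "nat \<Rightarrow> ('x \<Rightarrow> 'm \<Rightarrow> 'c \<Rightarrow> 'z \<Rightarrow> bool) \<Rightarrow> 'x \<Rightarrow>
    'm list \<times> 'c list \<times> 'z list \<Rightarrow> nat list \<Rightarrow> bool" where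
  "accept_ext k V x \<pi> ys = (wf_proof k \<pi> \<and> length ys = k \<and>
     (case \<pi> of (as, cs, zs) \<Rightarrow> (\<forall>i<k. ys ! i = 0 \<and> V x (as ! i) (cs ! i) (zs ! i))))"

definition oracle_fns :: "nat \<Rightarrow> nat \<Rightarrow> ('m list \<times> nat \<times> 'c \<times> 'z \<Rightarrow> nat) set" where
  "oracle_fns k l = {H. \<forall>u. (u \<in> hdom k \<longrightarrow> H u \<in> hvals l) \<and> (u \<notin> hdom k \<longrightarrow> H u = 0)}"

definition std_accept_prob :: "nat \<Rightarrow> nat \<Rightarrow> ('x \<Rightarrow> 'm \<Rightarrow> 'c \<Rightarrow> 'z \<Rightarrow> bool) \<Rightarrow> nat \<Rightarrow>
    (nat \<times> ('m list \<times> nat \<times> 'c \<times> 'z) \<times> nat \<Rightarrow> complex) \<Rightarrow>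
    (nat \<times> ('m list \<times> nat \<times> 'c \<times> 'z) \<times> nat \<Rightarrow> nat \<times> ('m list \<times> nat \<times> 'c \<times> 'z) \<times> nat \<Rightarrow> complex) list \<Rightarrow>
    (nat \<times> ('m list \<times> nat \<times> 'c \<times> 'z) \<times> nat \<Rightarrow> 'x \<times> 'm list \<times> 'c list \<times> 'z list) \<Rightarrow> real" where
  "std_accept_prob k l V d psi0 Us meas =
     (\<Sum>H\<in>oracle_fns k l. \<Sum>p\<in>pbasis k l d.
        (cmod (run_std (pbasis k l d) H Us psi0 p))\<^sup>2 *
        (if fischlin_verify k H V (fst (meas p)) (snd (meas p)) then 1 else 0))
     / real (card (oracle_fns k l :: ('m list \<times> nat \<times> 'c \<times> 'z \<Rightarrow> nat) set))"

text \<open>Verification of the output proof via the compressed oracle: k classical queries,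
  each with a fresh output register initialised to 0^l and measured; ys records the
  measured answers.  Malformed proofs are rejected without queries.\<close>
primrec ver_state :: "nat \<Rightarrow> nat \<Rightarrow> ('p \<Rightarrow> 'x \<times> 'm list \<times> 'c list \<times> 'z list) \<Rightarrow>
    ('p \<times> ('m list \<times> nat \<times> 'c \<times> 'z \<Rightarrow> nat option) \<Rightarrow> complex) \<Rightarrow> nat \<Rightarrow>
    ('p \<times> nat list) \<times> ('m list \<times> nat \<times> 'c \<times> 'z \<Rightarrow> nat option) \<Rightarrow> complex" where
  "ver_state k l meas \<Psi> 0 = (\<lambda>((p, ys), D). if ys = [] then \<Psi> (p, D) else 0)"
| "ver_state k l meas \<Psi> (Suc i) = (\<lambda>((p, ys'), D').
     if wf_proof k (snd (meas p)) then
       (if ys' = [] then 0 else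
          (let u = qpt (snd (meas p)) i in
           \<Sum>e\<in>dopts l. query_entry l (last ys', D' u) (0, e) *
                         ver_state k l meas \<Psi> i ((p, butlast ys'), D'(u := e))))
     else ver_state k l meas \<Psi> i ((p, ys'), D'))"

definition extract_pairs :: "('x \<Rightarrow> 'm \<Rightarrow> 'c \<Rightarrow> 'z \<Rightarrow> bool) \<Rightarrow> 'x \<Rightarrow>
    ('m list \<times> nat \<times> 'c \<times> 'z \<Rightarrow> nat option) \<Rightarrow>
    (('m list \<times> nat \<times> 'c \<times> 'z) \<times> ('m list \<times> nat \<times> 'c \<times> 'z)) set" where
  "extract_pairs V x D = {(u, u'). case (u, u') of ((as, i, c, z), (as', i', c', z')) \<Rightarrow>
      as = as' \<and> i = i' \<and> D u \<noteq> None \<and> D u' \<noteq> None \<and> (c, z) \<noteq> (c', z') \<and>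
      V x (as ! i) c z \<and> V x (as ! i) c' z'}"

text \<open>Output of the extractor from the measured database (None = abort);
  lexicographically first pair w.r.t. the lexicographic order on inputs.\<close>
definition extractor_output :: "('x \<Rightarrow> 'm \<Rightarrow> 'c \<Rightarrow> 'z \<Rightarrow> bool) \<Rightarrow>
    ('x \<Rightarrow> 'm \<Rightarrow> 'c \<Rightarrow> 'c \<Rightarrow> 'z \<Rightarrow> 'z \<Rightarrow> 'w) \<Rightarrow> 'x \<Rightarrow>
    ('m::linorder list \<times> nat \<times> 'c::linorder \<times> 'z::linorder \<Rightarrow> nat option) \<Rightarrow> 'w option" where
  "extractor_output V Ext x D = (let S = extract_pairs V x D in
     if S = {} then None else
     (case Min S of ((as, i, c, z), (_, _, c', z')) \<Rightarrow> Some (Ext x (as ! i) c c' z z')))"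

definition ext_event_prob :: "nat \<Rightarrow> nat \<Rightarrow> ('x \<Rightarrow> 'm \<Rightarrow> 'c \<Rightarrow> 'z \<Rightarrow> bool) \<Rightarrow>
    ('x \<Rightarrow> 'm \<Rightarrow> 'c \<Rightarrow> 'c \<Rightarrow> 'z \<Rightarrow> 'z \<Rightarrow> 'w) \<Rightarrow> nat \<Rightarrow>
    (nat \<times> ('m::linorder list \<times> nat \<times> 'c::linorder \<times> 'z::linorder) \<times> nat \<Rightarrow> complex) \<Rightarrow>
    (nat \<times> ('m list \<times> nat \<times> 'c \<times> 'z) \<times> nat \<Rightarrow> nat \<times> ('m list \<times> nat \<times> 'c \<times> 'z) \<times> nat \<Rightarrow> complex) list \<Rightarrow>
    (nat \<times> ('m list \<times> nat \<times> 'c \<times> 'z) \<times> nat \<Rightarrow> 'x \<times> 'm list \<times> 'c list \<times> 'z list) \<Rightarrow>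
    ('x \<times> 'm list \<times> 'c list \<times> 'z list \<Rightarrow> bool \<Rightarrow> 'w option \<Rightarrow> bool) \<Rightarrow> real" where
  "ext_event_prob k l V Ext d psi0 Us meas Ev =
    (let B = pbasis k l d;
         \<Psi>0 = (\<lambda>(p, D). psi0 p * (if D = (\<lambda>_. None) then 1 else 0));
         \<Psi> = run_comp B l Us \<Psi>0;
         \<Phi> = ver_state k l meas \<Psi> k
     in \<Sum>p\<in>B. \<Sum>ys\<in>{ys. length ys = k \<and> set ys \<subseteq> hvals l} \<union> {[]}. \<Sum>D\<in>db_basis k l.
          (cmod (\<Phi> ((p, ys), D)))\<^sup>2 *
          (let b = accept_ext k V (fst (meas p)) (snd (meas p)) ys;
               w = (if b then extractor_output V Ext (fst (meas p)) D else None)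
           in if Ev (meas p) b w then 1 else 0))"

definition bad_witness :: "('x \<times> 'w) set \<Rightarrow> 'x \<Rightarrow> 'w option \<Rightarrow> bool" where
  "bad_witness R x w = (case w of None \<Rightarrow> True | Some w' \<Rightarrow> (x, w') \<notin> R)"

end

theory Submission
  imports Defs "HOL-Analysis.L2_Norm"
begin

text \<open>For a commitment vector \<open>a\<close> let \<open>E\<^sub>a\<close> project onto the databases without any entry whose input
  contains \<open>a\<close>, and let \<open>\<Pi>\<^sub>a\<close> project onto query inputs containing \<open>a\<close>.  A query \<open>O\<close> satisfies
  \<open>O E\<^sub>a = O \<Pi>\<^sub>a E\<^sub>a + E\<^sub>a O - E\<^sub>a \<Pi>\<^sub>a O\<close>, because \<open>E\<^sub>a\<close> commutes with the queries outside \<open>a\<close>.  Applying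
  this after each of the \<open>m \<le> q\<close> queries, and using that the initial state is fixed by \<open>E\<^sub>a\<close>, splits
  the final state with output \<open>a\<close> into \<open>2m + 1\<close> terms, each continuing the run from a state that is
  empty at \<open>a\<close>; for each term the squared norms of these states, summed over \<open>a\<close>, are at most 1.

  From a state \<open>v\<close> that is empty at \<open>a\<close>, failure with output \<open>a\<close> has weight at most \<open>\<delta> \<parallel>v\<parallel>\<^sup>2\<close>: undoing
  the compression of all registers outside \<open>a\<close> turns them into a classical table, which a new prover
  can hold itself, while the registers at \<open>a\<close> are a fresh compressed oracle.  This only removes
  entries from the database of the extractor, so it does not make extraction easier.  The triangle
  inequality for the \<open>\<ell>\<^sub>2\<close>-norm over \<open>a\<close> gives \<open>(2m + 1)\<^sup>2 \<delta> \<le> 4 (q + k)\<^sup>2 \<delta>\<close>.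

  Undoing the compression of all registers gives the equality of the acceptance probabilities.\<close>

section \<open>The compression operator\<close>

lemma xor_hvals: "a \<in> hvals l \<Longrightarrow> b \<in> hvals l \<Longrightarrow> xor a b \<in> hvals l"
  unfolding hvals_def
  by (auto simp flip: take_bit_nat_eq_self_iff simp: take_bit_xor)

lemma finite_hvals [simp]: "finite (hvals l)"
  by (simp add: hvals_def)

lemma card_hvals [simp]: "card (hvals l) = 2 ^ l"
  by (simp add: hvals_def)

lemma zero_hvals [simp]: "0 \<in> hvals l"
  by (simp add: hvals_def)

lemma finite_dopts [simp]: "finite (dopts l)"
  by (simp add: dopts_def)

lemma None_dopts [simp]: "None \<in> dopts l"
  by (simp add: dopts_def)

lemma cnot_val_cnot_val [simp]: "cnot_val (cnot_val y e) e = y"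
  by (cases e) (simp_all add: xor.assoc)

lemma cnot_val_eq_iff: "y' = cnot_val y e \<longleftrightarrow> y = cnot_val y' e"
  by (metis cnot_val_cnot_val)

lemma cnot_val_hvals: "y \<in> hvals l \<Longrightarrow> e \<in> dopts l \<Longrightarrow> cnot_val y e \<in> hvals l"
  by (auto simp: dopts_def xor_hvals)

lemma sum_dopts: "(\<Sum>e\<in>dopts l. f e) = f None + (\<Sum>y\<in>hvals l. f (Some y))"
  unfolding dopts_def by (subst sum.insert) (auto simp: sum.reindex)

lemma comp_entry_commute: "comp_entry l a b = comp_entry l b a"
  by (auto simp: comp_entry_def split: option.splits)

lemma cnj_comp_entry [simp]: "cnj (comp_entry l a b) = comp_entry l a b"
  by (auto simp: comp_entry_def split: option.splits)

text \<open>\<open>Comp\<close> exchanges bottom with the uniform vector and fixes the orthogonal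
  complement, so it is its own inverse. In entries this rests on \<open>s * s = 1 / L\<close> and on
  the vanishing column and row sums \<open>d\<close> and \<open>d2\<close> of the block on proper
  values.\<close>

lemma comp_entry_involution:
  assumes "a \<in> dopts l" "b \<in> dopts l"
  shows "(\<Sum>e\<in>dopts l. comp_entry l a e * comp_entry l e b) = (if a = b then 1 else 0)"
proof -
  define L :: complex where "L = 2 ^ l"
  define s where "s = complex_of_real (1 / sqrt (2 ^ l))"
  have L0: "L \<noteq> 0" by (simp add: L_def)
  have ss: "s * s = 1 / L"
    unfolding s_def L_def of_real_mult [symmetric] by simp
  have r: "complex_of_real (1 / 2 ^ l) = 1 / L" by (simp add: L_def)
  have c: "of_nat (card (hvals l)) = L" by (simp add: L_def)
  have e1: "comp_entry l None None = 0" "comp_entry l None (Some y) = s"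
    "comp_entry l (Some y) None = s"
    "comp_entry l (Some y) (Some y') = (if y = y' then 1 else 0) - 1 / L" for y y'
    by (simp_all add: comp_entry_def s_def L_def)
  have d: "(\<Sum>y\<in>hvals l. (if y = y' then 1 else 0) - 1 / L) = 0" if "y' \<in> hvals l" for y'
    using that by (simp add: sum_subtractf L_def)
  have d2: "(\<Sum>y\<in>hvals l. (if y' = y then 1 else 0) - 1 / L) = 0" if "y' \<in> hvals l" for y'
    using that by (simp add: sum_subtractf L_def)
  show ?thesis
  proof (cases a)
    case None
    show ?thesis
    proof (cases b)
      case None
      with \<open>a = None\<close> show ?thesis using L0 by (simp add: sum_dopts e1 ss c L_def)
    next
      case (Some y')
      with assms have "y' \<in> hvals l" by (auto simp: dopts_def)
      with Some \<open>a = None\<close> show ?thesis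
        by (simp add: sum_dopts e1 sum_distrib_left [symmetric] d)
    qed
  next
    case (Some y)
    with assms have y: "y \<in> hvals l" by (auto simp: dopts_def)
    show ?thesis
    proof (cases b)
      case None
      with Some y show ?thesis
        by (simp add: sum_dopts e1 sum_distrib_right [symmetric] d2)
    next
      case b: (Some y')
      with assms have y': "y' \<in> hvals l" by (auto simp: dopts_def)
      have "(\<Sum>z\<in>hvals l. ((if y = z then 1 else 0) - 1 / L) * ((if z = y' then 1 else 0) - 1 / L))
        = (\<Sum>z\<in>hvals l. (if y = z then (if z = y' then 1 else 0) - 1 / L else 0)
              - ((if z = y' then 1 else 0) - 1 / L) / L)"
        by (intro sum.cong) (auto simp: algebra_simps diff_divide_distrib)
      also have "\<dots> = (if y = y' then 1 else 0) - 1 / L"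
        using y by (subst sum_subtractf, subst sum_divide_distrib [symmetric], subst d [OF y']) simp
      finally show ?thesis
        using b Some by (simp add: sum_dopts e1 ss)
    qed
  qed
qed

text \<open>A real symmetric involution is unitary. All norm preservation under decompression comes
  from here.\<close>

lemma sum_comp_entry_isometry:
  "(\<Sum>e\<in>dopts l. (cmod (\<Sum>e'\<in>dopts l. comp_entry l e e' * f e'))\<^sup>2) = (\<Sum>e\<in>dopts l. (cmod (f e))\<^sup>2)"
proof -
  have "complex_of_real (\<Sum>e\<in>dopts l. (cmod (\<Sum>e'\<in>dopts l. comp_entry l e e' * f e'))\<^sup>2)
      = (\<Sum>e\<in>dopts l. (\<Sum>a\<in>dopts l. comp_entry l e a * f a) * (\<Sum>b\<in>dopts l. comp_entry l e b * cnj (f b)))"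
    by (simp only: of_real_sum complex_norm_square cnj_sum complex_cnj_mult cnj_comp_entry)
  also have "\<dots> = (\<Sum>e\<in>dopts l. \<Sum>a\<in>dopts l. \<Sum>b\<in>dopts l.
       f a * cnj (f b) * (comp_entry l a e * comp_entry l e b))"
    by (simp add: sum_product mult_ac comp_entry_commute)
  also have "\<dots> = (\<Sum>a\<in>dopts l. \<Sum>b\<in>dopts l. \<Sum>e\<in>dopts l.
       f a * cnj (f b) * (comp_entry l a e * comp_entry l e b))"
    by (subst sum.swap, rule sum.cong [OF refl], rule sum.swap)
  also have "\<dots> = (\<Sum>a\<in>dopts l. \<Sum>b\<in>dopts l. if a = b then f a * cnj (f b) else 0)"
    by (intro sum.cong refl) (simp add: sum_distrib_left [symmetric] comp_entry_involution)
  also have "\<dots> = (\<Sum>a\<in>dopts l. f a * cnj (f a))"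
    by simp
  also have "\<dots> = complex_of_real (\<Sum>e\<in>dopts l. (cmod (f e))\<^sup>2)"
    by (simp only: of_real_sum complex_norm_square)
  finally show ?thesis by (simp only: of_real_eq_iff)
qed

text \<open>A query is \<open>Comp CNOT Comp\<close>, so one more \<open>Comp\<close> on the left
  cancels the outer one. This leaves \<open>CNOT\<close> controlled by the classical value
  \<open>e3\<close>, after a \<open>Comp\<close> on the input side.\<close>

lemma sum_comp_query_entry:
  assumes "e3 \<in> dopts l"
  shows "(\<Sum>e2\<in>dopts l. comp_entry l e3 e2 * query_entry l (y', e2) (y, e))
       = (if y' = cnot_val y e3 then comp_entry l e3 e else 0)"
proof -
  have "(\<Sum>e2\<in>dopts l. comp_entry l e3 e2 * query_entry l (y', e2) (y, e))
      = (\<Sum>e2\<in>dopts l. \<Sum>e1\<in>dopts l. (comp_entry l e3 e2 * comp_entry l e2 e1) *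
           (comp_entry l e1 e * (if y' = cnot_val y e1 then 1 else 0)))"
    by (simp only: query_entry_def split sum_distrib_left mult_ac case_prod_conv)
  also have "\<dots> = (\<Sum>e1\<in>dopts l. (if e3 = e1 then 1 else 0) *
           (comp_entry l e1 e * (if y' = cnot_val y e1 then 1 else 0)))"
    by (subst sum.swap, intro sum.cong refl)
       (simp only: sum_distrib_right [symmetric] comp_entry_involution [OF assms])
  also have "\<dots> = (\<Sum>e1\<in>dopts l. if e3 = e1 then
           (comp_entry l e1 e * (if y' = cnot_val y e1 then 1 else 0)) else 0)"
    by (intro sum.cong) auto
  also have "\<dots> = (if y' = cnot_val y e3 then comp_entry l e3 e else 0)"
    using assms by simp
  finally show ?thesis .
qed

text \<open>A query whose output register is uniform does nothing.\<close>

lemma sum_query_entry_output: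
  assumes "e2 \<in> dopts l" "e \<in> dopts l" "y' \<in> hvals l"
  shows "(\<Sum>y\<in>hvals l. query_entry l (y', e2) (y, e)) = (if e2 = e then 1 else 0)"
proof -
  have "(\<Sum>y\<in>hvals l. query_entry l (y', e2) (y, e))
     = (\<Sum>e1\<in>dopts l. \<Sum>y\<in>hvals l. comp_entry l e2 e1 * comp_entry l e1 e * (if y = cnot_val y' e1 then 1 else 0))"
    unfolding query_entry_def split case_prod_conv
    by (subst sum.swap) (simp only: cnot_val_eq_iff [of y'])
  also have "\<dots> = (\<Sum>e1\<in>dopts l. comp_entry l e2 e1 * comp_entry l e1 e)"
    using assms(3) by (intro sum.cong refl) (simp add: sum_distrib_left [symmetric] cnot_val_hvals)
  finally show ?thesis
    using assms by (simp add: comp_entry_involution)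
qed

section \<open>Databases\<close>

text \<open>\<open>db_basis\<close> over an arbitrary set of inputs, so that databases can be split
  along a subset of the domain and put together again by \<open>merge\<close>.\<close>

definition dbs :: "'u set \<Rightarrow> nat \<Rightarrow> ('u \<Rightarrow> nat option) set" where
  "dbs X l = {D. \<forall>u. (u \<notin> X \<longrightarrow> D u = None) \<and> (u \<in> X \<longrightarrow> D u \<in> dopts l)}"

lemma db_basis_eq: "db_basis k l = dbs (hdom k) l"
  by (simp add: db_basis_def dbs_def)

lemma finite_dbs [simp]:
  assumes "finite X" shows "finite (dbs X l)"
proof (rule finite_subset)
  show "dbs X l \<subseteq> {D. \<forall>u. (u \<in> X \<longrightarrow> D u \<in> dopts l) \<and> (u \<notin> X \<longrightarrow> D u = None)}"
    by (auto simp: dbs_def)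
  show "finite {D. \<forall>u. (u \<in> X \<longrightarrow> D u \<in> dopts l) \<and> (u \<notin> X \<longrightarrow> D u = None)}"
    by (rule finite_set_of_finite_funs) (use assms in auto)
qed

lemma dbs_upd: "D \<in> dbs X l \<Longrightarrow> u \<in> X \<Longrightarrow> e \<in> dopts l \<Longrightarrow> D(u := e) \<in> dbs X l"
  by (auto simp: dbs_def)

lemma dbs_dopts: "D \<in> dbs X l \<Longrightarrow> D u \<in> dopts l"
  by (cases "u \<in> X") (auto simp: dbs_def)

lemma dbs_support: "D \<in> dbs A l \<Longrightarrow> D u \<noteq> None \<Longrightarrow> u \<in> A"
  by (cases "u \<in> A") (simp_all add: dbs_def del: split_paired_All)

lemma dbs_mono: "A \<subseteq> X \<Longrightarrow> dbs A l \<subseteq> dbs X l"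
  using None_dopts by (fastforce simp: dbs_def)

lemma None_dbs [simp]: "(\<lambda>_. None) \<in> dbs X l"
  by (auto simp: dbs_def)

definition merge :: "'u set \<Rightarrow> ('u \<Rightarrow> nat option) \<Rightarrow> ('u \<Rightarrow> nat option) \<Rightarrow> 'u \<Rightarrow> nat option" where
  "merge A D G = (\<lambda>u. if u \<in> A then D u else G u)"

lemma merge_upd: "u \<in> A \<Longrightarrow> merge A (D(u := e)) G = (merge A D G)(u := e)"
  by (auto simp: merge_def)

lemma sum_dbs_merge:
  assumes "A \<subseteq> X"
  shows "(\<Sum>D\<in>dbs X l. h D) = (\<Sum>G\<in>dbs (X - A) l. \<Sum>D\<in>dbs A l. h (merge A D G))"
proof -
  have "(\<Sum>G\<in>dbs (X - A) l. \<Sum>D\<in>dbs A l. h (merge A D G))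
      = (\<Sum>(G, D)\<in>dbs (X - A) l \<times> dbs A l. h (merge A D G))"
    by (rule sum.cartesian_product)
  also have "\<dots> = (\<Sum>D\<in>dbs X l. h D)"
    by (rule sum.reindex_bij_witness [where
          i = "\<lambda>D. (merge A (\<lambda>_. None) D, merge A D (\<lambda>_. None))" and j = "\<lambda>(G, D). merge A D G"])
       (use assms in \<open>auto simp: dbs_def merge_def fun_eq_iff\<close>)
  finally show ?thesis by simp
qed

lemma sum_dbs_upd:
  assumes "u \<in> X"
  shows "(\<Sum>D\<in>dbs X l. h D) = (\<Sum>D\<in>dbs (X - {u}) l. \<Sum>e\<in>dopts l. h (D(u := e)))"
proof -
  have "(\<Sum>D\<in>dbs (X - {u}) l. \<Sum>e\<in>dopts l. h (D(u := e)))
      = (\<Sum>(D, e)\<in>dbs (X - {u}) l \<times> dopts l. h (D(u := e)))"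
    by (rule sum.cartesian_product)
  also have "\<dots> = (\<Sum>D\<in>dbs X l. h D)"
    by (rule sum.reindex_bij_witness [where
          i = "\<lambda>D. (D(u := None), D u)" and j = "\<lambda>(D, e). D(u := e)"])
       (use assms in \<open>auto simp: dbs_def fun_eq_iff\<close>)
  finally show ?thesis by simp
qed

section \<open>Decompressing registers\<close>

text \<open>\<open>Comp\<close> on register \<open>u\<close>; as \<open>Comp\<close> is an
  involution, this undoes the compression of that register.\<close>

definition decomp1 :: "nat \<Rightarrow> 'u \<Rightarrow> (('u \<Rightarrow> nat option) \<Rightarrow> complex) \<Rightarrow> ('u \<Rightarrow> nat option) \<Rightarrow> complex" where
  "decomp1 l u F = (\<lambda>D. \<Sum>e\<in>dopts l. comp_entry l (D u) e * F (D(u := e)))"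

definition decomp :: "nat \<Rightarrow> 'u list \<Rightarrow> (('u \<Rightarrow> nat option) \<Rightarrow> complex) \<Rightarrow> ('u \<Rightarrow> nat option) \<Rightarrow> complex" where
  "decomp l us = foldr (decomp1 l) us"

lemma decomp_simps [simp]:
  "decomp l [] F = F"
  "decomp l (u # us) F = decomp1 l u (decomp l us F)"
  by (simp_all add: decomp_def)

text \<open>The amplitude of output \<open>y'\<close> when \<open>u\<close> is queried with output register \<open>y\<close> and the
  registers in \<open>S\<close> are decompressed.\<close>

definition qstep :: "nat \<Rightarrow> 'u set \<Rightarrow> 'u \<Rightarrow> nat \<Rightarrow> nat \<Rightarrow>
    (('u \<Rightarrow> nat option) \<Rightarrow> complex) \<Rightarrow> ('u \<Rightarrow> nat option) \<Rightarrow> complex" where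
  "qstep l S u y' y F = (\<lambda>D. if u \<in> S then (if y' = cnot_val y (D u) then F D else 0)
     else (\<Sum>e\<in>dopts l. query_entry l (y', D u) (y, e) * F (D(u := e))))"

text \<open>For fixed values of the other registers this is the unitarity of \<open>Comp\<close>.
  The weight \<open>g\<close> will be the indicator of an event that ignores register
  \<open>u\<close>, so the register may be decompressed before the event is tested.\<close>

lemma decomp1_isometry:
  assumes "u \<in> X" "\<And>D e. g (D(u := e)) = g D"
  shows "(\<Sum>D\<in>dbs X l. (cmod (decomp1 l u F D))\<^sup>2 * g D) = (\<Sum>D\<in>dbs X l. (cmod (F D))\<^sup>2 * g D)"
  by (simp add: sum_dbs_upd [OF assms(1)] assms(2) decomp1_def
      sum_distrib_right [symmetric] sum_comp_entry_isometry)

lemma decomp_isometry: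
  assumes "set us \<subseteq> X" "\<And>D u e. u \<in> set us \<Longrightarrow> g (D(u := e)) = g D"
  shows "(\<Sum>D\<in>dbs X l. (cmod (decomp l us F D))\<^sup>2 * g D) = (\<Sum>D\<in>dbs X l. (cmod (F D))\<^sup>2 * g D)"
  using assms
proof (induction us)
  case (Cons u us)
  then show ?case
    by (simp only: decomp_simps list.set insert_subset)
       (subst decomp1_isometry; blast)
qed simp

lemma decomp1_cong:
  assumes "\<And>D. D \<in> dbs X l \<Longrightarrow> F D = F' D" "D \<in> dbs X l" "u \<in> X"
  shows "decomp1 l u F D = decomp1 l u F' D"
  unfolding decomp1_def using assms by (intro sum.cong) (auto simp: dbs_upd)

lemma decomp_sum: "decomp l us (\<lambda>D. \<Sum>i\<in>I. c i * F i D) = (\<lambda>D. \<Sum>i\<in>I. c i * decomp l us (F i) D)"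
proof (induction us)
  case (Cons u us)
  show ?case
    unfolding decomp_simps Cons decomp1_def sum_distrib_left
    by (rule ext, subst sum.swap) (simp only: mult_ac)
qed simp

text \<open>On the queried register the outer \<open>Comp\<close> cancels and the query becomes a
  classical lookup, which is how \<open>u0\<close> enters the set \<open>S\<close>. On any other
  register \<open>Comp\<close> commutes with the query.\<close>

lemma decomp1_qstep:
  assumes D: "D \<in> dbs X l" and u0: "u0 \<notin> S"
  shows "decomp1 l u0 (qstep l S u y' y F) D = qstep l (insert u0 S) u y' y (decomp1 l u0 F) D"
proof (cases "u = u0")
  case True
  have "decomp1 l u0 (qstep l S u y' y F) D
      = (\<Sum>e2\<in>dopts l. \<Sum>e\<in>dopts l. (comp_entry l (D u) e2 * query_entry l (y', e2) (y, e)) * F (D(u := e)))"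
    using u0 True by (simp add: decomp1_def qstep_def sum_distrib_left mult.assoc)
  also have "\<dots> = (\<Sum>e\<in>dopts l. (if y' = cnot_val y (D u) then comp_entry l (D u) e else 0) * F (D(u := e)))"
    by (subst sum.swap, intro sum.cong refl)
       (simp only: sum_distrib_right [symmetric] sum_comp_query_entry [OF dbs_dopts [OF D]])
  also have "\<dots> = qstep l (insert u0 S) u y' y (decomp1 l u0 F) D"
    using True by (simp add: qstep_def decomp1_def)
  finally show ?thesis .
next
  case False
  show ?thesis
  proof (cases "u \<in> S")
    case True
    then show ?thesis using False by (simp add: qstep_def decomp1_def)
  next
    case uS: False
    have "decomp1 l u0 (qstep l S u y' y F) D
      = (\<Sum>e0\<in>dopts l. \<Sum>e\<in>dopts l. comp_entry l (D u0) e0 * (query_entry l (y', D u) (y, e) * F (D(u := e, u0 := e0))))"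
      using False uS by (simp add: decomp1_def qstep_def sum_distrib_left fun_upd_twist)
    also have "\<dots> = qstep l (insert u0 S) u y' y (decomp1 l u0 F) D"
      using False uS
      by (subst sum.swap) (simp add: decomp1_def qstep_def sum_distrib_left mult_ac)
    finally show ?thesis .
  qed
qed

lemma decomp_qstep:
  assumes "D \<in> dbs X l" "distinct us" "set us \<subseteq> X"
  shows "decomp l us (qstep l {} u y' y F) D = qstep l (set us) u y' y (decomp l us F) D"
  using assms
proof (induction us arbitrary: D)
  case (Cons u0 us)
  have "decomp l (u0 # us) (qstep l {} u y' y F) D
      = decomp1 l u0 (qstep l (set us) u y' y (decomp l us F)) D"
    using Cons by (auto intro!: decomp1_cong [of X])
  also have "\<dots> = qstep l (set (u0 # us)) u y' y (decomp l (u0 # us) F) D"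
    using Cons.prems by (simp add: decomp1_qstep)
  finally show ?case .
qed simp

text \<open>\<open>Comp\<close> sends bottom to the uniform vector, so the empty database becomes
  the uniform superposition of all tables filled exactly on \<open>us\<close>.\<close>

lemma decomp_init:
  assumes "distinct us"
  shows "decomp l us (\<lambda>D. c * (if D = (\<lambda>_. None) then 1 else 0)) D
     = c * (if \<forall>u. D u \<noteq> None \<longleftrightarrow> u \<in> set us then complex_of_real (1 / sqrt (2 ^ l)) ^ length us else 0)"
  using assms
proof (induction us arbitrary: D)
  case Nil
  then show ?case by (auto simp: fun_eq_iff)
next
  case (Cons u us)
  let ?s = "complex_of_real (1 / sqrt (2 ^ l))"
  \<comment> \<open>The operators for \<open>us\<close> do not touch register \<open>u\<close>,
    which still holds bottom; hence only \<open>e = None\<close> contributes below.\<close>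
  have *: "(\<forall>v. (D(u := e)) v \<noteq> None \<longleftrightarrow> v \<in> set us) \<longleftrightarrow>
      e = None \<and> (\<forall>v. v \<noteq> u \<longrightarrow> (D v \<noteq> None \<longleftrightarrow> v \<in> set us))" for e
    using Cons.prems by auto
  have "decomp l (u # us) (\<lambda>D. c * (if D = (\<lambda>_. None) then 1 else 0)) D
     = (\<Sum>e\<in>dopts l. if e = None then comp_entry l (D u) e * (c *
        (if \<forall>v. v \<noteq> u \<longrightarrow> (D v \<noteq> None \<longleftrightarrow> v \<in> set us) then ?s ^ length us else 0)) else 0)"
    using Cons unfolding decomp_simps
    by (subst decomp1_def, intro sum.cong refl) (simp only: * distinct.simps, auto)
  also have "\<dots> = comp_entry l (D u) None * (c *
        (if \<forall>v. v \<noteq> u \<longrightarrow> (D v \<noteq> None \<longleftrightarrow> v \<in> set us) then ?s ^ length us else 0))"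
    by simp
  also have "\<dots> = c * (if \<forall>v. D v \<noteq> None \<longleftrightarrow> v \<in> set (u # us) then ?s ^ length (u # us) else 0)"
    by (cases "D u") (simp_all add: comp_entry_def, (metis option.distinct(1))+)
  finally show ?case .
qed

section \<open>Runs with partially decompressed oracle\<close>

text \<open>For \<open>S = {}\<close> this is the compressed query, and for \<open>S\<close> the
  whole domain a lookup in a classical table. In between, the oracle is classical on
  \<open>S\<close> and compressed elsewhere.\<close>

definition genquery :: "nat \<Rightarrow> 'u set \<Rightarrow> ((nat \<times> 'u \<times> nat) \<times> ('u \<Rightarrow> nat option) \<Rightarrow> complex)
    \<Rightarrow> (nat \<times> 'u \<times> nat) \<times> ('u \<Rightarrow> nat option) \<Rightarrow> complex" where
  "genquery l S \<Psi> = (\<lambda>((w, u, y'), D). \<Sum>y\<in>hvals l. qstep l S u y' y (\<lambda>D. \<Psi> ((w, u, y), D)) D)"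

fun grun :: "(nat \<times> 'u \<times> nat) set \<Rightarrow> nat \<Rightarrow> 'u set \<Rightarrow> ((nat \<times> 'u \<times> nat) \<Rightarrow> (nat \<times> 'u \<times> nat) \<Rightarrow> complex) list
    \<Rightarrow> ((nat \<times> 'u \<times> nat) \<times> ('u \<Rightarrow> nat option) \<Rightarrow> complex)
    \<Rightarrow> (nat \<times> 'u \<times> nat) \<times> ('u \<Rightarrow> nat option) \<Rightarrow> complex" where
  "grun B l S [] \<Psi> = \<Psi>"
| "grun B l S [U] \<Psi> = lift_U B U \<Psi>"
| "grun B l S (U # U' # Us) \<Psi> = grun B l S (U' # Us) (genquery l S (lift_U B U \<Psi>))"

abbreviation pset :: "nat \<Rightarrow> 'u set \<Rightarrow> nat \<Rightarrow> (nat \<times> 'u \<times> nat) set" where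
  "pset d X l \<equiv> {0..<d} \<times> X \<times> hvals l"

definition dstate :: "nat \<Rightarrow> 'u list \<Rightarrow> ('p \<times> ('u \<Rightarrow> nat option) \<Rightarrow> complex) \<Rightarrow> 'p \<times> ('u \<Rightarrow> nat option) \<Rightarrow> complex" where
  "dstate l us \<Psi> = (\<lambda>(p, D). decomp l us (\<lambda>D. \<Psi> (p, D)) D)"

lemma cquery_eq_genquery: "cquery l \<Psi> = genquery l {} \<Psi>"
  by (simp add: cquery_def genquery_def qstep_def)

lemma run_comp_eq_grun: "run_comp B l Us \<Psi> = grun B l {} Us \<Psi>"
  by (induction Us arbitrary: \<Psi> rule: induct_list012) (simp_all add: cquery_eq_genquery)

lemma lift_U_cong:
  assumes "\<And>p. p \<in> B \<Longrightarrow> f (p, D) = g (p, D)"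
  shows "lift_U B U f (p, D) = lift_U B U g (p, D)"
  using assms by (auto simp: lift_U_def intro!: sum.cong)

lemma qstep_cong:
  assumes "\<And>D. D \<in> dbs X l \<Longrightarrow> F D = F' D" "D \<in> dbs X l" "u \<in> X"
  shows "qstep l S u y' y F D = qstep l S u y' y F' D"
  using assms by (auto simp: qstep_def dbs_upd intro!: sum.cong)

lemma genquery_cong:
  assumes "\<And>p D. p \<in> pset d X l \<Longrightarrow> D \<in> dbs X l \<Longrightarrow> f (p, D) = g (p, D)"
    and "p \<in> pset d X l" "D \<in> dbs X l"
  shows "genquery l S f (p, D) = genquery l S g (p, D)"
proof -
  obtain w u y where "p = (w, u, y)" by (cases p)
  with assms show ?thesis
    by (auto simp: genquery_def intro!: sum.cong qstep_cong [of X])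
qed

lemma grun_cong:
  assumes "\<And>p D. p \<in> pset d X l \<Longrightarrow> D \<in> dbs X l \<Longrightarrow> f (p, D) = g (p, D)"
    and "p \<in> pset d X l" "D \<in> dbs X l"
  shows "grun (pset d X l) l S Us f (p, D) = grun (pset d X l) l S Us g (p, D)"
  using assms
proof (induction Us arbitrary: f g p D rule: induct_list012)
  case (2 U)
  then show ?case by (simp add: lift_U_cong [of _ f _ g])
next
  case (3 U U' Us)
  show ?case
    unfolding grun.simps
    by (rule 3(2)) (auto intro!: genquery_cong [of d X] lift_U_cong 3(3) simp: 3(4,5))
qed simp

lemma dstate_lift_U: "dstate l us (lift_U B U \<Psi>) = lift_U B U (dstate l us \<Psi>)"
  by (auto simp: dstate_def lift_U_def decomp_sum)

lemma dstate_genquery: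
  assumes "D \<in> dbs X l" "distinct us" "set us \<subseteq> X"
  shows "dstate l us (genquery l {} \<Psi>) (p, D) = genquery l (set us) (dstate l us \<Psi>) (p, D)"
proof -
  obtain w u y' where p: "p = (w, u, y')" by (cases p)
  show ?thesis
    using decomp_sum [of l us "\<lambda>_. 1" "\<lambda>y. qstep l {} u y' y (\<lambda>D. \<Psi> ((w, u, y), D))" "hvals l"]
    by (simp add: p dstate_def genquery_def decomp_qstep [OF assms])
qed

text \<open>Decompression acts on the database only, so it passes through the unitaries, and it
  turns each compressed query into a \<open>genquery\<close>. It can therefore be moved from the end
  of a run to its beginning.\<close>

lemma dstate_grun:
  assumes "D \<in> dbs X l" "p \<in> pset d X l" "distinct us" "set us \<subseteq> X"
  shows "dstate l us (grun (pset d X l) l {} Us \<Psi>) (p, D) = grun (pset d X l) l (set us) Us (dstate l us \<Psi>) (p, D)"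
  using assms(1,2)
proof (induction Us arbitrary: \<Psi> p D rule: induct_list012)
  case (3 U U' Us)
  then have "dstate l us (grun (pset d X l) l {} (U # U' # Us) \<Psi>) (p, D)
     = grun (pset d X l) l (set us) (U' # Us) (dstate l us (genquery l {} (lift_U (pset d X l) U \<Psi>))) (p, D)"
    by simp
  also have "\<dots> = grun (pset d X l) l (set us) (U' # Us) (genquery l (set us) (dstate l us (lift_U (pset d X l) U \<Psi>))) (p, D)"
    by (rule grun_cong) (use 3 assms in \<open>auto simp: dstate_genquery\<close>)
  finally show ?case by (simp add: dstate_lift_U)
qed (simp_all add: dstate_lift_U)

text \<open>Xor with a fixed value is an involution, so exactly one value of \<open>y\<close> leads
  to a given output and the sum collapses: the query only permutes basis states.\<close>

lemma genquery_full:
  assumes "p \<in> pset d X l" "D \<in> dbs X l"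
  shows "genquery l X \<Psi> (p, D) = \<Psi> ((\<lambda>(w, u, y). (w, u, cnot_val y (D u))) p, D)"
proof -
  obtain w u y' where p: "p = (w, u, y')" by (cases p)
  with assms have "u \<in> X" "cnot_val y' (D u) \<in> hvals l"
    by (auto intro: cnot_val_hvals dbs_dopts)
  then show ?thesis
    by (simp add: p genquery_def qstep_def cnot_val_eq_iff [of y'])
qed

section \<open>Preservation of the norm by unitaries and queries\<close>

lemma unitary_on_isometry:
  assumes "finite B" "unitary_on B U"
  shows "(\<Sum>a\<in>B. (cmod (\<Sum>b\<in>B. U a b * f b))\<^sup>2) = (\<Sum>b\<in>B. (cmod (f b))\<^sup>2)"
proof -
  have "complex_of_real (\<Sum>a\<in>B. (cmod (\<Sum>b\<in>B. U a b * f b))\<^sup>2)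
     = (\<Sum>c\<in>B. (\<Sum>b\<in>B. U c b * f b) * (\<Sum>a\<in>B. cnj (U c a) * cnj (f a)))"
    by (simp only: of_real_sum complex_norm_square cnj_sum complex_cnj_mult)
  also have "\<dots> = (\<Sum>c\<in>B. \<Sum>b\<in>B. \<Sum>a\<in>B. f b * cnj (f a) * (cnj (U c a) * U c b))"
    by (simp add: sum_product mult_ac)
  also have "\<dots> = (\<Sum>b\<in>B. \<Sum>a\<in>B. \<Sum>c\<in>B. f b * cnj (f a) * (cnj (U c a) * U c b))"
    by (subst sum.swap, rule sum.cong [OF refl], rule sum.swap)
  also have "\<dots> = (\<Sum>b\<in>B. \<Sum>a\<in>B. if a = b then f b * cnj (f a) else 0)"
    using assms(2) by (intro sum.cong refl) (simp add: sum_distrib_left [symmetric] unitary_on_def)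
  also have "\<dots> = complex_of_real (\<Sum>b\<in>B. (cmod (f b))\<^sup>2)"
    by (simp only: of_real_sum complex_norm_square sum.delta [OF assms(1)]) (simp cong: sum.cong)
  finally show ?thesis by (simp only: of_real_eq_iff)
qed

definition nsq :: "'p set \<Rightarrow> 'd set \<Rightarrow> ('p \<times> 'd \<Rightarrow> complex) \<Rightarrow> real" where
  "nsq B C \<Psi> = (\<Sum>p\<in>B. \<Sum>D\<in>C. (cmod (\<Psi> (p, D)))\<^sup>2)"

lemma nsq_nonneg [simp]: "0 \<le> nsq B C \<Psi>"
  by (simp add: nsq_def sum_nonneg)

lemma nsq_lift_U:
  assumes "finite B" "unitary_on B U"
  shows "nsq B C (lift_U B U \<Psi>) = nsq B C \<Psi>"
  unfolding nsq_def
  by (subst (1 2) sum.swap) (simp add: lift_U_def unitary_on_isometry [OF assms])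

lemma nsq_dstate:
  assumes "set us \<subseteq> X"
  shows "nsq B (dbs X l) (dstate l us \<Psi>) = nsq B (dbs X l) \<Psi>"
  using decomp_isometry [OF assms, of "\<lambda>_. 1"] by (simp add: nsq_def dstate_def)

text \<open>After decompressing all registers, which preserves the norm, a query is for each fixed
  \<open>D\<close> a self-inverse permutation of the prover's basis states.\<close>

lemma nsq_cquery:
  assumes "finite X"
  shows "nsq (pset d X l) (dbs X l) (cquery l \<Psi>) = nsq (pset d X l) (dbs X l) \<Psi>"
proof -
  obtain us where us: "set us = X" "distinct us"
    using finite_distinct_list [OF assms] by blast
  define \<Phi> where "\<Phi> = dstate l us \<Psi>"
  have "nsq (pset d X l) (dbs X l) (cquery l \<Psi>) = nsq (pset d X l) (dbs X l) (dstate l us (cquery l \<Psi>))"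
    by (simp add: nsq_dstate us)
  also have "\<dots> = (\<Sum>D\<in>dbs X l. \<Sum>p\<in>pset d X l. (cmod (\<Phi> ((\<lambda>(w, u, y). (w, u, cnot_val y (D u))) p, D)))\<^sup>2)"
    unfolding nsq_def \<Phi>_def cquery_eq_genquery
    by (subst sum.swap, intro sum.cong refl) (simp only: dstate_genquery us genquery_full order.refl)
  also have "\<dots> = (\<Sum>D\<in>dbs X l. \<Sum>p\<in>pset d X l. (cmod (\<Phi> (p, D)))\<^sup>2)"
  proof (rule sum.cong [OF refl])
    fix D assume D: "D \<in> dbs X l"
    show "(\<Sum>p\<in>pset d X l. (cmod (\<Phi> ((\<lambda>(w, u, y). (w, u, cnot_val y (D u))) p, D)))\<^sup>2)
       = (\<Sum>p\<in>pset d X l. (cmod (\<Phi> (p, D)))\<^sup>2)"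
      by (rule sum.reindex_bij_witness [where
            i = "\<lambda>(w, u, y). (w, u, cnot_val y (D u))" and j = "\<lambda>(w, u, y). (w, u, cnot_val y (D u))"])
         (use D in \<open>auto intro: cnot_val_hvals dbs_dopts\<close>)
  qed
  also have "\<dots> = nsq (pset d X l) (dbs X l) \<Phi>"
    unfolding nsq_def by (rule sum.swap)
  also have "\<dots> = nsq (pset d X l) (dbs X l) \<Psi>"
    by (simp add: \<Phi>_def nsq_dstate us)
  finally show ?thesis .
qed

section \<open>Verification queries\<close>

text \<open>The unnormalised branch of the verification in which every answer is 0: each query
  starts with output register 0 and is projected on 0. Registers in \<open>S\<close> are taken as
  decompressed.\<close>

primrec vf :: "nat \<Rightarrow> ('m list \<times> nat \<times> 'c \<times> 'z) set \<Rightarrow> 'm list \<times> 'c list \<times> 'z list \<Rightarrow> nat \<Rightarrow>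
    (('m list \<times> nat \<times> 'c \<times> 'z \<Rightarrow> nat option) \<Rightarrow> complex) \<Rightarrow>
    ('m list \<times> nat \<times> 'c \<times> 'z \<Rightarrow> nat option) \<Rightarrow> complex" where
  "vf l S \<pi> 0 F = F"
| "vf l S \<pi> (Suc i) F = qstep l S (qpt \<pi> i) 0 0 (vf l S \<pi> i F)"

lemma ver_state_eq_vf:
  assumes "wf_proof k (snd (meas p))"
  shows "ver_state k l meas \<Psi> i ((p, replicate i 0), D) = vf l {} (snd (meas p)) i (\<lambda>D. \<Psi> (p, D)) D"
proof (induction i arbitrary: D)
  case (Suc i)
  have r: "replicate (Suc i) (0::nat) = replicate i 0 @ [0]"
    by (simp add: replicate_append_same)
  have "butlast (replicate (Suc i) (0::nat)) = replicate i 0" "last (replicate (Suc i) (0::nat)) = 0"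
    unfolding r by simp_all
  with Suc assms show ?case
    by (simp add: qstep_def Let_def fun_upd_def del: replicate.simps)
qed simp

lemma qpt_hdom: "wf_proof k \<pi> \<Longrightarrow> i < k \<Longrightarrow> qpt \<pi> i \<in> hdom k"
  by (auto simp: wf_proof_def qpt_def hdom_def)

lemma vf_cong:
  assumes "\<And>D. D \<in> dbs X l \<Longrightarrow> F D = F' D" "D \<in> dbs X l" "\<And>j. j < i \<Longrightarrow> qpt \<pi> j \<in> X"
  shows "vf l S \<pi> i F D = vf l S \<pi> i F' D"
  using assms(2,3) by (induction i arbitrary: D) (auto simp: assms(1) intro!: qstep_cong [of X])

lemma decomp_vf:
  assumes "distinct us" "set us \<subseteq> X" "D \<in> dbs X l" "\<And>j. j < i \<Longrightarrow> qpt \<pi> j \<in> X"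
  shows "decomp l us (vf l {} \<pi> i F) D = vf l (set us) \<pi> i (decomp l us F) D"
  using assms(3,4)
  by (induction i arbitrary: D) (auto simp: decomp_qstep [OF _ assms(1,2)] intro!: qstep_cong [of X])

text \<open>Acceptance forces every measured answer to be 0, so an event that implies acceptance
  sees only the branch \<open>replicate k 0\<close>, and the sum over answer lists
  disappears.\<close>

lemma sum_event_answers:
  assumes "\<And>m b w. Ev m b w \<Longrightarrow> b"
  shows "ext_event_prob k l V Ext d psi0 Us meas Ev
     = (\<Sum>p\<in>pbasis k l d. \<Sum>D\<in>db_basis k l.
          (cmod (vf l {} (snd (meas p)) k
             (\<lambda>D. run_comp (pbasis k l d) l Us (\<lambda>(p, D). psi0 p * (if D = (\<lambda>_. None) then 1 else 0)) (p, D)) D))\<^sup>2 *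
          (if accept_ext k V (fst (meas p)) (snd (meas p)) (replicate k 0) \<and>
              Ev (meas p) True (extractor_output V Ext (fst (meas p)) D) then 1 else 0))"
proof -
  let ?Y = "{ys. length ys = k \<and> set ys \<subseteq> hvals l} \<union> {[]}"
  define \<Psi> where "\<Psi> = run_comp (pbasis k l d) l Us (\<lambda>(p, D). psi0 p * (if D = (\<lambda>_. None) then 1 else 0))"
  have fin: "finite ?Y"
    using finite_lists_length_eq [OF finite_hvals, of l k] by (simp add: conj_commute)
  have mem: "replicate k 0 \<in> ?Y"
    by (auto simp: set_replicate_conv_if)
  have acc: "ys = replicate k 0" if "accept_ext k V x \<pi> ys" for x \<pi> ys
    using that by (auto simp: accept_ext_def list_eq_iff_nth_eq)
  have "(\<Sum>ys\<in>?Y. \<Sum>D\<in>db_basis k l. (cmod (ver_state k l meas \<Psi> k ((p, ys), D)))\<^sup>2 *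
          (let b = accept_ext k V (fst (meas p)) (snd (meas p)) ys;
               w = (if b then extractor_output V Ext (fst (meas p)) D else None)
           in if Ev (meas p) b w then 1 else 0))
     = (\<Sum>D\<in>db_basis k l. (cmod (vf l {} (snd (meas p)) k (\<lambda>D. \<Psi> (p, D)) D))\<^sup>2 *
          (if accept_ext k V (fst (meas p)) (snd (meas p)) (replicate k 0) \<and>
              Ev (meas p) True (extractor_output V Ext (fst (meas p)) D) then 1 else 0))" (is "sum ?f _ = ?r")
    for p
  proof -
    have "?f ys = (if ys = replicate k 0 then ?r else 0)" for ys
    proof (cases "accept_ext k V (fst (meas p)) (snd (meas p)) ys")
      case True
      then have "ys = replicate k 0" "wf_proof k (snd (meas p))"
        using acc [OF True] by (auto simp: accept_ext_def)
      with True show ?thesis by (auto simp: ver_state_eq_vf intro!: sum.cong)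
    next
      case False
      with assms have "\<not> Ev (meas p) False None" by blast
      with False show ?thesis by auto
    qed
    then show ?thesis
      using sum.delta [OF fin, of "replicate k 0" "\<lambda>_. ?r"] mem by simp
  qed
  then show ?thesis
    unfolding ext_event_prob_def Let_def \<Psi>_def by (intro sum.cong refl)
qed

section \<open>Equality of the acceptance probabilities\<close>

text \<open>Reading bottom as 0 agrees with \<open>cnot_val\<close>, which does nothing on
  \<open>None\<close>, and with the value 0 of the functions in \<open>oracle_fns\<close> outside
  the domain.\<close>

definition fn_of_db :: "('u \<Rightarrow> nat option) \<Rightarrow> 'u \<Rightarrow> nat" where
  "fn_of_db D = (\<lambda>u. case D u of None \<Rightarrow> 0 | Some h \<Rightarrow> h)"

lemma cnot_val_fn_of_db: "cnot_val y (D u) = xor y (fn_of_db D u)"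
  by (cases "D u") (simp_all add: fn_of_db_def)

text \<open>Fully decompressed queries never change \<open>D\<close>, so the run splits into one
  standard run for each table.\<close>

lemma grun_full:
  assumes "\<And>p. p \<in> pset d X l \<Longrightarrow> \<Psi> (p, D) = \<psi> p" "p \<in> pset d X l" "D \<in> dbs X l"
  shows "grun (pset d X l) l X Us \<Psi> (p, D) = run_std (pset d X l) (fn_of_db D) Us \<psi> p"
  using assms
proof (induction Us arbitrary: \<Psi> \<psi> p rule: induct_list012)
  case (3 U U' Us)
  show ?case
    unfolding grun.simps run_std.simps
  proof (rule 3(2) [OF _ 3(4,5)])
    fix p assume p: "p \<in> pset d X l"
    show "genquery l X (lift_U (pset d X l) U \<Psi>) (p, D) = squery (fn_of_db D) (apply_U (pset d X l) U \<psi>) p"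
      by (simp add: genquery_full [OF p 3(5)] squery_def lift_U_def apply_U_def cnot_val_fn_of_db 3(3)
          split: prod.splits cong: sum.cong)
  qed
qed (auto simp: lift_U_def apply_U_def intro!: sum.cong)

lemma run_std_scale: "run_std B H Us (\<lambda>p. c * \<psi> p) = (\<lambda>p. c * run_std B H Us \<psi> p)"
proof (induction Us arbitrary: \<psi> rule: induct_list012)
  case (3 U U' Us)
  have "squery H (apply_U B U (\<lambda>p. c * \<psi> p)) = (\<lambda>p. c * squery H (apply_U B U \<psi>) p)"
    by (auto simp: squery_def apply_U_def sum_distrib_left mult_ac)
  with 3 show ?case by simp
qed (auto simp: apply_U_def sum_distrib_left mult_ac)

lemma vf_full:
  assumes "\<And>j. j < i \<Longrightarrow> qpt \<pi> j \<in> X"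
  shows "vf l X \<pi> i F D = (if \<forall>j<i. fn_of_db D (qpt \<pi> j) = 0 then F D else 0)"
  using assms by (induction i) (auto simp: qstep_def cnot_val_fn_of_db less_Suc_eq)

lemma finite_hdom [simp]: "finite (hdom k :: ('m::finite list \<times> nat \<times> 'c::finite \<times> 'z::finite) set)"
proof (rule finite_subset)
  show "hdom k \<subseteq> {as::'m list. set as \<subseteq> UNIV \<and> length as = k} \<times> {..<k} \<times> UNIV"
    by (auto simp: hdom_def)
qed (intro finite_cartesian_product finite_lists_length_eq; simp)

text \<open>Tables filled exactly on the domain correspond one to one to the functions in
  \<open>oracle_fns\<close>.\<close>

lemma sum_uniform_db:
  fixes h :: "('m::finite list \<times> nat \<times> 'c::finite \<times> 'z::finite \<Rightarrow> nat) \<Rightarrow> real"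
  shows "(\<Sum>D\<in>dbs (hdom k) l. (if \<forall>u. D u \<noteq> None \<longleftrightarrow> u \<in> hdom k then c else 0) * h (fn_of_db D))
       = c * (\<Sum>H\<in>oracle_fns k l. h H)"
proof -
  let ?P = "\<lambda>D. \<forall>u. D u \<noteq> None \<longleftrightarrow> u \<in> hdom k"
  have "(\<Sum>D\<in>dbs (hdom k) l. (if ?P D then c else 0) * h (fn_of_db D))
     = (\<Sum>D\<in>{D \<in> dbs (hdom k) l. ?P D}. c * h (fn_of_db D))"
    by (rule sum.mono_neutral_cong_right) auto
  also have "\<dots> = (\<Sum>H\<in>oracle_fns k l. c * h H)"
    by (rule sum.reindex_bij_witness [where j = fn_of_db and
          i = "\<lambda>H u. if u \<in> hdom k then Some (H u) else None"])
       (auto simp: fn_of_db_def oracle_fns_def dbs_def dopts_def fun_eq_iff split: option.splits,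
        metis not_Some_eq, metis imageE option.inject option.distinct(1))
  finally show ?thesis by (simp add: sum_distrib_left)
qed

text \<open>Acceptance does not look at the final database, so all registers may be decompressed
  before summing over it. The state is then a superposition of tables with common amplitude
  \<open>s\<close>, and on each table the prover and the verification act as with a fixed
  function.\<close>

lemma ext_accept_prob_eq_std:
  fixes V :: "'x \<Rightarrow> 'm::{finite,linorder} \<Rightarrow> 'c::{finite,linorder} \<Rightarrow> 'z::{finite,linorder} \<Rightarrow> bool"
  shows "ext_event_prob k l V Ext d psi0 Us meas (\<lambda>_ b _. b) = std_accept_prob k l V d psi0 Us meas"
proof -
  let ?X = "hdom k :: ('m list \<times> nat \<times> 'c \<times> 'z) set"
  let ?B = "pset d ?X l"
  obtain us where us: "set us = ?X" "distinct us"
    using finite_distinct_list [OF finite_hdom] by blast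
  define s where "s = complex_of_real (1 / sqrt (2 ^ l)) ^ length us"
  define \<kappa> where "\<kappa> D = (if \<forall>u. D u \<noteq> None \<longleftrightarrow> u \<in> ?X then s else 0)" for D :: "'m list \<times> nat \<times> 'c \<times> 'z \<Rightarrow> nat option"
  define \<Psi>0 where "\<Psi>0 = (\<lambda>(p :: nat \<times> ('m list \<times> nat \<times> 'c \<times> 'z) \<times> nat, D :: 'm list \<times> nat \<times> 'c \<times> 'z \<Rightarrow> nat option). psi0 p * (if D = (\<lambda>_. None) then 1 else 0))"
  define \<Psi> where "\<Psi> = run_comp ?B l Us \<Psi>0"
  define acc where "acc p \<longleftrightarrow> accept_ext k V (fst (meas p)) (snd (meas p)) (replicate k 0)" for p
  have norm_\<kappa>: "(cmod (\<kappa> D))\<^sup>2 = (if \<forall>u. D u \<noteq> None \<longleftrightarrow> u \<in> ?X then (cmod s)\<^sup>2 else 0)" for D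
    by (simp add: \<kappa>_def)
  have init: "dstate l us \<Psi>0 (p, D) = \<kappa> D * psi0 p" for p D
    using decomp_init [OF us(2), of l "psi0 p" D] by (simp add: dstate_def \<Psi>0_def \<kappa>_def s_def us(1) mult_ac)
  have \<Psi>: "decomp l us (\<lambda>D. \<Psi> (p, D)) D = \<kappa> D * run_std ?B (fn_of_db D) Us psi0 p"
    if "p \<in> ?B" "D \<in> dbs ?X l" for p D
  proof -
    have "decomp l us (\<lambda>D. \<Psi> (p, D)) D = grun ?B l ?X Us (dstate l us \<Psi>0) (p, D)"
      using dstate_grun [OF that(2,1) us(2), of Us \<Psi>0] us(1)
      by (simp add: \<Psi>_def run_comp_eq_grun dstate_def)
    also have "\<dots> = run_std ?B (fn_of_db D) Us (\<lambda>p. \<kappa> D * psi0 p) p"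
      by (rule grun_full [of d ?X l "dstate l us \<Psi>0"]) (use init that in auto)
    finally show ?thesis by (simp add: run_std_scale)
  qed
  \<comment> \<open>The normalisation of \<open>s\<close> is obtained without counting functions:
    decompression preserves the norm 1 of the empty database.\<close>
  have one: "(cmod s)\<^sup>2 * card (oracle_fns k l :: ('m list \<times> nat \<times> 'c \<times> 'z \<Rightarrow> nat) set) = 1"
  proof -
    have "(cmod s)\<^sup>2 * card (oracle_fns k l :: ('m list \<times> nat \<times> 'c \<times> 'z \<Rightarrow> nat) set)
       = (\<Sum>D\<in>dbs ?X l. (cmod (\<kappa> D))\<^sup>2 * 1)"
      unfolding norm_\<kappa> by (subst sum_uniform_db) simp
    also have "\<dots> = (\<Sum>D\<in>dbs ?X l. (cmod (decomp l us (\<lambda>D. 1 * (if D = (\<lambda>_. None) then 1 else 0)) D))\<^sup>2 * 1)"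
      unfolding decomp_init [OF us(2)] us(1) \<kappa>_def s_def by simp
    also have "\<dots> = (\<Sum>D\<in>dbs ?X l. (cmod (1 * (if D = (\<lambda>_. None) then 1 else 0)))\<^sup>2 * 1)"
      by (rule decomp_isometry) (simp_all add: us)
    also have "\<dots> = (\<Sum>D\<in>dbs ?X l. if D = (\<lambda>_. None) then 1 else 0)"
      by (intro sum.cong) auto
    finally show ?thesis by simp
  qed
  have ver: "fischlin_verify k H V (fst (meas p)) (snd (meas p)) \<longleftrightarrow>
      acc p \<and> (\<forall>j<k. H (qpt (snd (meas p)) j) = 0)" for H p
    by (auto simp: fischlin_verify_def acc_def accept_ext_def qpt_def split: prod.splits)
  have "(\<Sum>D\<in>dbs ?X l. (cmod (vf l {} (snd (meas p)) k (\<lambda>D. \<Psi> (p, D)) D))\<^sup>2 * (if acc p then 1 else 0))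
     = (cmod s)\<^sup>2 * (\<Sum>H\<in>oracle_fns k l. (cmod (run_std ?B H Us psi0 p))\<^sup>2 *
          (if fischlin_verify k H V (fst (meas p)) (snd (meas p)) then 1 else 0))" (is "?L = ?R")
    if p: "p \<in> ?B" for p
  proof (cases "acc p")
    case True
    then have q: "\<And>j. j < k \<Longrightarrow> qpt (snd (meas p)) j \<in> ?X"
      by (auto simp: acc_def accept_ext_def qpt_hdom)
    have "?L = (\<Sum>D\<in>dbs ?X l. (cmod (decomp l us (vf l {} (snd (meas p)) k (\<lambda>D. \<Psi> (p, D))) D))\<^sup>2 * (if acc p then 1 else 0))"
      by (rule decomp_isometry [symmetric]) (simp_all add: us)
    also have "\<dots> = (\<Sum>D\<in>dbs ?X l. (cmod (vf l ?X (snd (meas p)) k (\<lambda>D. \<kappa> D * run_std ?B (fn_of_db D) Us psi0 p) D))\<^sup>2)"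
    proof (intro sum.cong refl)
      fix D assume D: "D \<in> dbs ?X l"
      have "decomp l us (vf l {} (snd (meas p)) k (\<lambda>D. \<Psi> (p, D))) D
        = vf l ?X (snd (meas p)) k (decomp l us (\<lambda>D. \<Psi> (p, D))) D"
        using decomp_vf [where X = ?X, OF us(2) _ D q] us(1) by simp
      also have "\<dots> = vf l ?X (snd (meas p)) k (\<lambda>D. \<kappa> D * run_std ?B (fn_of_db D) Us psi0 p) D"
        by (rule vf_cong [OF \<Psi> [OF p] D q])
      finally show "(cmod (decomp l us (vf l {} (snd (meas p)) k (\<lambda>D. \<Psi> (p, D))) D))\<^sup>2 * (if acc p then 1 else 0)
         = (cmod (vf l ?X (snd (meas p)) k (\<lambda>D. \<kappa> D * run_std ?B (fn_of_db D) Us psi0 p) D))\<^sup>2"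
        using True by simp
    qed
    also have "\<dots> = (\<Sum>D\<in>dbs ?X l. (if \<forall>u. D u \<noteq> None \<longleftrightarrow> u \<in> ?X then (cmod s)\<^sup>2 else 0) *
        ((cmod (run_std ?B (fn_of_db D) Us psi0 p))\<^sup>2 *
          (if fischlin_verify k (fn_of_db D) V (fst (meas p)) (snd (meas p)) then 1 else 0)))"
      unfolding norm_\<kappa> [symmetric]
      using True by (intro sum.cong refl) (auto simp: vf_full [OF q] ver norm_mult power_mult_distrib)
    also have "\<dots> = ?R"
      by (rule sum_uniform_db)
    finally show ?thesis .
  qed (simp add: ver)
  then have "ext_event_prob k l V Ext d psi0 Us meas (\<lambda>_ b _. b)
    = (\<Sum>p\<in>?B. (cmod s)\<^sup>2 * (\<Sum>H\<in>oracle_fns k l. (cmod (run_std ?B H Us psi0 p))\<^sup>2 *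
          (if fischlin_verify k H V (fst (meas p)) (snd (meas p)) then 1 else 0)))"
    by (subst sum_event_answers)
       (simp_all add: \<Psi>_def \<Psi>0_def acc_def pbasis_def db_basis_eq cong: sum.cong)
  also have "\<dots> = (cmod s)\<^sup>2 * (\<Sum>H\<in>oracle_fns k l. \<Sum>p\<in>?B. (cmod (run_std ?B H Us psi0 p))\<^sup>2 *
          (if fischlin_verify k H V (fst (meas p)) (snd (meas p)) then 1 else 0))"
    unfolding sum_distrib_left [symmetric] by (subst sum.swap) simp
  also have "\<dots> = std_accept_prob k l V d psi0 Us meas"
  proof -
    have "real (card (oracle_fns k l :: ('m list \<times> nat \<times> 'c \<times> 'z \<Rightarrow> nat) set)) \<noteq> 0"
      using one by (metis mult_zero_right zero_neq_one)
    then have "(cmod s)\<^sup>2 = 1 / real (card (oracle_fns k l :: ('m list \<times> nat \<times> 'c \<times> 'z \<Rightarrow> nat) set))"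
      using one by (metis nonzero_eq_divide_eq)
    then show ?thesis
      unfolding std_accept_prob_def pbasis_def by simp
  qed
  finally show ?thesis .
qed

section \<open>Simulating a run with classical answers outside a set of oracle inputs\<close>

text \<open>The simulating prover knows a classical database \<open>G\<close> outside \<open>A\<close> and keeps an ancilla output
  register in the uniform state, stored in the low-order \<open>l\<close> bits of the workspace.  Before each
  query it swaps the ancilla into the output register if the input is outside \<open>A\<close>, so that the
  query is void; afterwards it swaps back and adds the answer given by \<open>G\<close>.\<close>

definition ws :: "nat \<Rightarrow> nat \<times> 'u \<times> nat \<Rightarrow> nat \<times> 'u \<times> nat" where
  "ws l = (\<lambda>(n, u, y). (n div 2 ^ l, u, y))"

definition anc :: "nat \<Rightarrow> nat \<times> 'u \<times> nat \<Rightarrow> nat" where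
  "anc l = (\<lambda>(n, u, y). n mod 2 ^ l)"

definition swap_in :: "nat \<Rightarrow> 'u set \<Rightarrow> nat \<times> 'u \<times> nat \<Rightarrow> nat \<times> 'u \<times> nat" where
  "swap_in l A = (\<lambda>(n, u, y). if u \<in> A then (n, u, y) else ((n div 2 ^ l) * 2 ^ l + y, u, n mod 2 ^ l))"

definition swap_out :: "nat \<Rightarrow> 'u set \<Rightarrow> ('u \<Rightarrow> nat option) \<Rightarrow> nat \<times> 'u \<times> nat \<Rightarrow> nat \<times> 'u \<times> nat" where
  "swap_out l A G = (\<lambda>(n, u, y). if u \<in> A then (n, u, y)
     else ((n div 2 ^ l) * 2 ^ l + y, u, cnot_val (n mod 2 ^ l) (G u)))"

text \<open>As an operator: complete the previous query by \<open>swap_out\<close>, apply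
  \<open>U\<close> to the simulated register and the identity to the ancilla, then prepare the next
  query by \<open>swap_in\<close>. The first operator thus begins with an extra
  \<open>swap_out\<close> and the last one ends with an extra \<open>swap_in\<close>; the initial
  state and the final measurement will compensate for these.\<close>

definition sim_U :: "nat \<Rightarrow> 'u set \<Rightarrow> ('u \<Rightarrow> nat option) \<Rightarrow> (nat \<times> 'u \<times> nat \<Rightarrow> nat \<times> 'u \<times> nat \<Rightarrow> complex) \<Rightarrow>
    nat \<times> 'u \<times> nat \<Rightarrow> nat \<times> 'u \<times> nat \<Rightarrow> complex" where
  "sim_U l A G U = (\<lambda>b b'. if anc l (swap_in l A b) = anc l (swap_out l A G b')
     then U (ws l (swap_in l A b)) (ws l (swap_out l A G b')) else 0)"

section \<open>Permutations of the enlarged basis and unitarity of the simulating operators\<close>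

lemma mult_add_less_mult:
  fixes w :: nat assumes "w < d" "y < L" shows "w * L + y < d * L"
proof -
  have "w * L + y < Suc w * L" using assms by simp
  also have "\<dots> \<le> d * L" using assms by (intro mult_right_mono) auto
  finally show ?thesis .
qed

lemma pset_swap_in: "b \<in> pset (d * 2 ^ l) X l \<Longrightarrow> swap_in l A b \<in> pset (d * 2 ^ l) X l"
  by (auto simp: swap_in_def hvals_def less_mult_imp_div_less intro!: mult_add_less_mult)

lemma swap_in_swap_in: "b \<in> pset (d * 2 ^ l) X l \<Longrightarrow> swap_in l A (swap_in l A b) = b"
  by (auto simp: swap_in_def hvals_def div_mult_mod_eq)

lemma pset_swap_out:
  "b \<in> pset (d * 2 ^ l) X l \<Longrightarrow> G \<in> dbs Y l \<Longrightarrow> swap_out l A G b \<in> pset (d * 2 ^ l) X l"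
  using cnot_val_hvals [OF _ dbs_dopts, of _ l G Y]
  by (auto simp: swap_out_def hvals_def less_mult_imp_div_less intro!: mult_add_less_mult)

lemma pset_ws: "b \<in> pset (d * 2 ^ l) X l \<Longrightarrow> ws l b \<in> pset d X l"
  by (auto simp: ws_def less_mult_imp_div_less)

lemma anc_hvals: "anc l b \<in> hvals l"
  by (auto simp: anc_def hvals_def split: prod.split)

lemma ws_anc_inject: "ws l b = ws l b' \<Longrightarrow> anc l b = anc l b' \<Longrightarrow> b = b'"
  using div_mult_mod_eq [of "fst b" "2 ^ l"] div_mult_mod_eq [of "fst b'" "2 ^ l"]
  by (cases b; cases b') (simp add: ws_def anc_def)

lemma inj_on_swap_out: "inj_on (swap_out l A G) (pset (d * 2 ^ l) X l)"
proof (rule inj_on_inverseI)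
  fix b assume "b \<in> pset (d * 2 ^ l) X l"
  then show "(\<lambda>(n, u, y). if u \<in> A then (n, u, y)
     else ((n div 2 ^ l) * 2 ^ l + cnot_val y (G u), u, n mod 2 ^ l)) (swap_out l A G b) = b"
    by (auto simp: swap_out_def hvals_def div_mult_mod_eq)
qed

lemma finite_pset: "finite X \<Longrightarrow> finite (pset d X l)"
  by simp

lemma sum_swap_out:
  assumes "finite X" "G \<in> dbs Y l"
  shows "(\<Sum>b\<in>pset (d * 2 ^ l) X l. h (swap_out l A G b)) = (\<Sum>b\<in>pset (d * 2 ^ l) X l. h b)"
proof -
  have "swap_out l A G ` pset (d * 2 ^ l) X l = pset (d * 2 ^ l) X l"
    by (intro endo_inj_surj inj_on_swap_out finite_pset image_subsetI pset_swap_out [OF _ assms(2)] assms(1))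
  then show ?thesis
    using sum.reindex [OF inj_on_swap_out, of h l A G d X] by simp
qed

lemma sum_swap_in:
  "(\<Sum>b\<in>pset (d * 2 ^ l) X l. h (swap_in l A b)) = (\<Sum>b\<in>pset (d * 2 ^ l) X l. h b)"
  by (rule sum.reindex_bij_witness [where i = "swap_in l A" and j = "swap_in l A"])
     (auto simp: swap_in_swap_in pset_swap_in simp del: mem_Sigma_iff)

text \<open>Division with remainder by \<open>2 ^ l\<close> identifies the enlarged basis with pairs
  of an original basis state and an ancilla value.\<close>

lemma sum_ws_anc:
  "(\<Sum>b\<in>pset (d * 2 ^ l) X l. h (ws l b) (anc l b)) = (\<Sum>p\<in>pset d X l. \<Sum>y\<in>hvals l. h p y)"
proof -
  have "(\<Sum>p\<in>pset d X l. \<Sum>y\<in>hvals l. h p y) = (\<Sum>(p, y)\<in>pset d X l \<times> hvals l. h p y)"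
    by (rule sum.cartesian_product)
  also have "\<dots> = (\<Sum>b\<in>pset (d * 2 ^ l) X l. h (ws l b) (anc l b))"
    by (rule sum.reindex_bij_witness [where
          i = "\<lambda>b. (ws l b, anc l b)" and j = "\<lambda>((w, u, y), y2). (w * 2 ^ l + y2, u, y)"])
       (auto simp: ws_def anc_def hvals_def less_mult_imp_div_less div_mult_mod_eq intro!: mult_add_less_mult)
  finally show ?thesis by simp
qed

lemma sum_ws: "(\<Sum>b\<in>pset (d * 2 ^ l) X l. h (ws l b)) = 2 ^ l * (\<Sum>p\<in>pset d X l. h p :: real)"
  using sum_ws_anc [of "\<lambda>p _. h p"] by (simp add: sum_distrib_left)

text \<open>The operator is \<open>U\<close> tensored with the identity on the ancilla, between two
  permutations of the basis.\<close>

lemma sim_U_unitary: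
  assumes "finite X" "G \<in> dbs Y l" "unitary_on (pset d X l) U"
  shows "unitary_on (pset (d * 2 ^ l) X l) (sim_U l A G U)"
  unfolding unitary_on_def
proof (intro ballI)
  let ?B' = "pset (d * 2 ^ l) X l"
  fix a b assume ab: "a \<in> ?B'" "b \<in> ?B'"
  let ?a = "swap_out l A G a" and ?b = "swap_out l A G b"
  have ab': "ws l ?a \<in> pset d X l" "ws l ?b \<in> pset d X l"
    using ab assms by (auto intro!: pset_ws pset_swap_out simp del: mem_Sigma_iff)
  have "(\<Sum>c\<in>?B'. cnj (sim_U l A G U c a) * sim_U l A G U c b)
     = (\<Sum>c\<in>?B'. (\<lambda>c. if anc l c = anc l ?a \<and> anc l c = anc l ?b then cnj (U (ws l c) (ws l ?a)) * U (ws l c) (ws l ?b) else 0) (swap_in l A c))"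
    by (intro sum.cong refl) (simp add: sim_U_def)
  also have "\<dots> = (\<Sum>c\<in>?B'. (if anc l c = anc l ?a \<and> anc l c = anc l ?b then cnj (U (ws l c) (ws l ?a)) * U (ws l c) (ws l ?b) else 0))"
    by (rule sum_swap_in)
  also have "\<dots> = (\<Sum>p\<in>pset d X l. \<Sum>y\<in>hvals l. if y = anc l ?a \<and> y = anc l ?b then cnj (U p (ws l ?a)) * U p (ws l ?b) else 0)"
    by (rule sum_ws_anc)
  also have "\<dots> = (\<Sum>p\<in>pset d X l. \<Sum>y\<in>hvals l. if y = anc l ?a then
       (if anc l ?a = anc l ?b then cnj (U p (ws l ?a)) * U p (ws l ?b) else 0) else 0)"
    by (intro sum.cong refl) auto
  also have "\<dots> = (\<Sum>p\<in>pset d X l. if anc l ?a = anc l ?b then cnj (U p (ws l ?a)) * U p (ws l ?b) else 0)"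
    by (intro sum.cong refl) (simp add: anc_hvals)
  also have "\<dots> = (if anc l ?a = anc l ?b then \<Sum>p\<in>pset d X l. cnj (U p (ws l ?a)) * U p (ws l ?b) else 0)"
    by simp
  also have "\<dots> = (if anc l ?a = anc l ?b \<and> ws l ?a = ws l ?b then 1 else 0)"
  proof -
    have "(\<Sum>p\<in>pset d X l. cnj (U p (ws l ?a)) * U p (ws l ?b)) = (if ws l ?a = ws l ?b then 1 else 0)"
      by (rule bspec [OF bspec [OF assms(3) [unfolded unitary_on_def] ab'(1)] ab'(2)])
    then show ?thesis by (cases "anc l ?a = anc l ?b") (simp_all only: if_True if_False simp_thms)
  qed
  also have "anc l ?a = anc l ?b \<and> ws l ?a = ws l ?b \<longleftrightarrow> a = b"
    using ws_anc_inject [of l ?a ?b] inj_onD [OF inj_on_swap_out _ ab] by auto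
  finally show "(\<Sum>c\<in>?B'. cnj (sim_U l A G U c a) * sim_U l A G U c b) = (if a = b then 1 else 0)" .
qed

text \<open>Here \<open>f\<close> is a state of the simulating prover with its compressed database,
  and \<open>t\<close> a state of the original run with the registers outside \<open>A\<close>
  decompressed, taken at the table \<open>G\<close>. Since \<open>f\<close> sees \<open>b\<close>
  only through \<open>ws l (\<sigma> b)\<close>, the ancilla is uniform; since it vanishes unless
  \<open>D \<in> dbs A l\<close>, nothing is recorded outside \<open>A\<close>. The factor
  \<open>c\<close> absorbs the normalisation.\<close>

definition simulates where
  "simulates l d X A G c \<sigma> f t \<longleftrightarrow> (\<forall>b\<in>pset (d * 2 ^ l) X l. \<forall>D\<in>dbs X l.
     f (b, D) = (if D \<in> dbs A l then c * t (ws l (\<sigma> b), merge A D G) else (0::complex)))"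

lemma simulates_lift_U:
  assumes "finite X" "G \<in> dbs Y l"
    and sim: "simulates l d X A G c (swap_out l A G) f t"
  shows "simulates l d X A G c (swap_in l A) (lift_U (pset (d * 2 ^ l) X l) (sim_U l A G U) f) (lift_U (pset d X l) U t)"
  unfolding simulates_def
proof (intro ballI)
  let ?B' = "pset (d * 2 ^ l) X l"
  fix b D assume b: "b \<in> ?B'" and D: "D \<in> dbs X l"
  let ?b = "swap_in l A b"
  show "lift_U ?B' (sim_U l A G U) f (b, D)
    = (if D \<in> dbs A l then c * lift_U (pset d X l) U t (ws l ?b, merge A D G) else 0)"
  proof (cases "D \<in> dbs A l")
    case True
    have "lift_U ?B' (sim_U l A G U) f (b, D)
      = (\<Sum>b'\<in>?B'. (\<lambda>b'. if anc l b' = anc l ?b then c * (U (ws l ?b) (ws l b') * t (ws l b', merge A D G)) else 0) (swap_out l A G b'))"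
      unfolding lift_U_def split case_prod_conv
      using sim D True by (intro sum.cong refl) (auto simp: simulates_def sim_U_def simp del: mem_Sigma_iff)
    also have "\<dots> = (\<Sum>b'\<in>?B'. if anc l b' = anc l ?b then c * (U (ws l ?b) (ws l b') * t (ws l b', merge A D G)) else 0)"
      by (rule sum_swap_out [OF assms(1,2)])
    also have "\<dots> = (\<Sum>p\<in>pset d X l. \<Sum>y\<in>hvals l. if y = anc l ?b then c * (U (ws l ?b) p * t (p, merge A D G)) else 0)"
      by (rule sum_ws_anc)
    also have "\<dots> = (\<Sum>p\<in>pset d X l. c * (U (ws l ?b) p * t (p, merge A D G)))"
      by (intro sum.cong refl) (simp add: anc_hvals)
    finally show ?thesis using True by (simp add: lift_U_def sum_distrib_left)
  next
    case False
    then show ?thesis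
      using sim D by (auto simp: lift_U_def simulates_def simp del: mem_Sigma_iff intro!: sum.neutral)
  qed
qed

lemma dbs_upd_iff:
  assumes "u \<in> A" "D \<in> dbs X l" "e \<in> dopts l"
  shows "D(u := e) \<in> dbs A l \<longleftrightarrow> D \<in> dbs A l"
  using assms dbs_dopts [OF assms(2), of u] by (auto simp: dbs_def)

text \<open>For an input in \<open>A\<close> both sides make the same compressed query. For any
  other input the simulating prover offers the uniform ancilla, so its query is void, and the answer
  of \<open>G\<close> is added by \<open>swap_out\<close>.\<close>

lemma simulates_query:
  assumes "A \<subseteq> X" "G \<in> dbs (X - A) l"
    and sim: "simulates l d X A G c (swap_in l A) f t"
  shows "simulates l d X A G c (swap_out l A G) (cquery l f) (genquery l (X - A) t)"
  unfolding simulates_def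
proof (intro ballI)
  let ?B' = "pset (d * 2 ^ l) X l"
  fix b D assume b: "b \<in> ?B'" and D: "D \<in> dbs X l"
  obtain n u y' where b_eq: "b = (n, u, y')" by (cases b)
  have n: "n < d * 2 ^ l" and u: "u \<in> X" and y': "y' \<in> hvals l" using b b_eq by auto
  have f: "f ((n, u, y), E) = (if E \<in> dbs A l then c * t (ws l (swap_in l A (n, u, y)), merge A E G) else 0)"
    if "y \<in> hvals l" "E \<in> dbs X l" for y E
    using sim that n u by (auto simp: simulates_def)
  show "cquery l f (b, D) = (if D \<in> dbs A l
      then c * genquery l (X - A) t (ws l (swap_out l A G b), merge A D G) else 0)"
  proof (cases "u \<in> A")
    case True
    have "cquery l f (b, D) = (\<Sum>y\<in>hvals l. \<Sum>e\<in>dopts l. query_entry l (y', D u) (y, e) *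
        (if D \<in> dbs A l then c * t ((n div 2 ^ l, u, y), (merge A D G)(u := e)) else 0))"
      unfolding cquery_def b_eq split case_prod_conv
      using True by (intro sum.cong refl)
        (simp add: f dbs_upd [OF D u] dbs_upd_iff [OF True D] swap_in_def ws_def merge_upd)
    also have "\<dots> = (if D \<in> dbs A l
      then c * genquery l (X - A) t (ws l (swap_out l A G b), merge A D G) else 0)"
      using True by (auto simp: b_eq genquery_def qstep_def swap_out_def ws_def sum_distrib_left mult_ac merge_def)
    finally show ?thesis .
  next
    case False
    \<comment> \<open>The output register now holds the ancilla, so the amplitude does not depend on
      \<open>y\<close> and \<open>sum_query_entry_output\<close> applies.\<close>
    let ?F = "\<lambda>E. if E \<in> dbs A l then c * t ((n div 2 ^ l, u, n mod 2 ^ l), merge A E G) else 0"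
    have "cquery l f (b, D) = (\<Sum>y\<in>hvals l. \<Sum>e\<in>dopts l. query_entry l (y', D u) (y, e) * ?F (D(u := e)))"
      unfolding cquery_def b_eq split case_prod_conv
      using False by (intro sum.cong refl)
        (simp add: f dbs_upd [OF D u] swap_in_def ws_def hvals_def)
    also have "\<dots> = (\<Sum>e\<in>dopts l. (if D u = e then 1 else 0) * ?F (D(u := e)))"
      by (subst sum.swap, intro sum.cong refl)
         (simp only: sum_distrib_right [symmetric] sum_query_entry_output [OF dbs_dopts [OF D] _ y'])
    also have "\<dots> = (\<Sum>e\<in>dopts l. if D u = e then ?F (D(u := e)) else 0)"
      by (intro sum.cong) auto
    also have "\<dots> = ?F D"
      using dbs_dopts [OF D] by simp
    also have "\<dots> = (if D \<in> dbs A l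
      then c * genquery l (X - A) t (ws l (swap_out l A G b), merge A D G) else 0)"
    proof -
      have "y' < 2 ^ l" using y' by (simp add: hvals_def)
      moreover have "n mod 2 ^ l \<in> hvals l" by (simp add: hvals_def)
      moreover have "cnot_val (n mod 2 ^ l) (G u) = cnot_val y (G u) \<longleftrightarrow> n mod 2 ^ l = y" for y
        by (metis cnot_val_cnot_val)
      ultimately show ?thesis
        using False u
        by (simp add: b_eq genquery_def qstep_def swap_out_def ws_def merge_def)
    qed
    finally show ?thesis .
  qed
qed

lemma simulates_run:
  assumes "finite X" "A \<subseteq> X" "G \<in> dbs (X - A) l" "Us \<noteq> []"
    and "simulates l d X A G c (swap_out l A G) f t"
  shows "simulates l d X A G c (swap_in l A)
     (run_comp (pset (d * 2 ^ l) X l) l (map (sim_U l A G) Us) f) (grun (pset d X l) l (X - A) Us t)"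
  using assms(4,5)
proof (induction Us arbitrary: f t rule: induct_list012)
  case (2 U)
  then show ?case using assms by (simp add: simulates_lift_U)
next
  case (3 U U' Us)
  show ?case
    using 3(2) [OF _ simulates_query [OF assms(2,3) simulates_lift_U [OF assms(1,3) 3(4)]]] by simp
qed simp

text \<open>The verification queries only inputs in \<open>A\<close>, where both sides use a
  compressed oracle, so it leaves \<open>G\<close> alone.\<close>

lemma vf_merge:
  assumes "A \<subseteq> X" "\<And>D. D \<in> dbs X l \<Longrightarrow> F' D = (if D \<in> dbs A l then c * F (merge A D G) else 0)"
    and "D \<in> dbs X l" "\<And>j. j < i \<Longrightarrow> qpt \<pi> j \<in> A"
  shows "vf l {} \<pi> i F' D = (if D \<in> dbs A l then c * vf l (X - A) \<pi> i F (merge A D G) else 0)"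
  using assms(3,4)
proof (induction i arbitrary: D)
  case 0
  then show ?case by (simp add: assms(2))
next
  case (Suc i)
  let ?u = "qpt \<pi> i"
  have u: "?u \<in> A" using Suc by simp
  with assms have uX: "?u \<in> X" by auto
  have "vf l {} \<pi> (Suc i) F' D = (\<Sum>e\<in>dopts l. query_entry l (0, D ?u) (0, e) *
      (if D \<in> dbs A l then c * vf l (X - A) \<pi> i F ((merge A D G)(?u := e)) else 0))"
    using Suc uX
    by (simp add: qstep_def, intro sum.cong refl)
       (simp add: dbs_upd dbs_upd_iff [OF u Suc.prems(1)] merge_upd [OF u])
  then show ?case
    using u by (simp add: qstep_def sum_distrib_left mult_ac) (simp add: merge_def)
qed

lemma run_comp_zero: "run_comp B l Us (\<lambda>_. 0) = (\<lambda>_. 0)"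
proof (induction Us rule: induct_list012)
  case (3 U U' Us)
  have "cquery l (lift_U B U (\<lambda>_. 0)) = (\<lambda>_. 0)"
    by (auto simp: cquery_def lift_U_def)
  with 3 show ?case by simp
qed (auto simp: lift_U_def)

section \<open>Failure of the extractor\<close>

definition region :: "nat \<Rightarrow> 'm list \<Rightarrow> ('m list \<times> nat \<times> 'c \<times> 'z) set" where
  "region k a = {u \<in> hdom k. fst u = a}"

text \<open>The search is restricted to entries in \<open>region k a\<close>. The event then ignores
  all other registers, which may be decompressed, and a failed search in the whole database implies
  a failed search here.\<close>

definition no_pair :: "('x \<Rightarrow> 'm \<Rightarrow> 'c \<Rightarrow> 'z \<Rightarrow> bool) \<Rightarrow> 'm list \<Rightarrow> nat \<Rightarrow>
    'x \<times> 'm list \<times> 'c list \<times> 'z list \<Rightarrow> ('m list \<times> nat \<times> 'c \<times> 'z \<Rightarrow> nat option) \<Rightarrow> bool" where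
  "no_pair V a k m D \<longleftrightarrow> accept_ext k V (fst m) (snd m) (replicate k 0) \<and> fst (snd m) = a \<and>
     extract_pairs V (fst m) (merge (region k a) D (\<lambda>_. None)) = {}"

lemma region_subset: "region k a \<subseteq> hdom k"
  by (auto simp: region_def)

lemma no_pair_qpt: "no_pair V a k m D \<Longrightarrow> i < k \<Longrightarrow> qpt (snd m) i \<in> region k a"
  by (auto simp: no_pair_def accept_ext_def wf_proof_def qpt_def region_def hdom_def split: prod.splits)

lemma vf_linear: "vf l S \<pi> i (\<lambda>D. F D + c * F' D) = (\<lambda>D. vf l S \<pi> i F D + c * vf l S \<pi> i F' D)"
  by (induction i) (auto simp: qstep_def sum.distrib sum_distrib_left algebra_simps)

lemma vf_zero: "vf l S \<pi> i (\<lambda>D. 0) = (\<lambda>D. 0)"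
  by (induction i) (auto simp: qstep_def)

text \<open>Unique responses force the two challenges of a chosen pair to differ, and special
  soundness then yields a valid witness. Finiteness ensures that \<open>Min\<close> lies in the set
  of pairs.\<close>

lemma bad_witness_no_pair:
  assumes "\<And>x a c c' z z'. c \<noteq> c' \<Longrightarrow> V x a c z \<Longrightarrow> V x a c' z' \<Longrightarrow> (x, Ext x a c c' z z') \<in> R"
    and "\<And>x a c z z'. z \<noteq> z' \<Longrightarrow> \<not> (V x a c z \<and> V x a c z')"
    and "bad_witness R x (extractor_output V Ext x D)" and "finite {u. D u \<noteq> None}"
  shows "extract_pairs V x D = {}"
proof (rule ccontr)
  assume ne: "extract_pairs V x D \<noteq> {}"
  have "extract_pairs V x D \<subseteq> {u. D u \<noteq> None} \<times> {u. D u \<noteq> None}"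
    by (auto simp: extract_pairs_def)
  then have "finite (extract_pairs V x D)"
    using assms(4) by (meson finite_SigmaI finite_subset)
  with ne have "Min (extract_pairs V x D) \<in> extract_pairs V x D" by simp
  moreover obtain as i c z as' i' c' z' where
    M: "Min (extract_pairs V x D) = ((as, i, c, z), (as', i', c', z'))"
    by (metis prod.exhaust)
  ultimately have "(c, z) \<noteq> (c', z')" "V x (as ! i) c z" "V x (as ! i) c' z'"
    by (auto simp: extract_pairs_def)
  moreover from this have "c \<noteq> c'"
    using assms(2) by (metis (full_types))
  ultimately have "(x, Ext x (as ! i) c c' z z') \<in> R"
    using assms(1) by blast
  with assms(3) ne M show False
    by (simp add: extractor_output_def Let_def bad_witness_def)
qed

text \<open>With the table \<open>G\<close> fixed, the simulating prover is a legitimate prover once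
  its state is normalised. Its failure probability is at most \<open>\<delta>\<close> and dominates
  the left-hand side up to the normalising factor.\<close>

lemma simulated_failure_bound:
  fixes V :: "'x \<Rightarrow> 'm::{finite,linorder} \<Rightarrow> 'c::{finite,linorder} \<Rightarrow> 'z::{finite,linorder} \<Rightarrow> bool"
    and meas :: "nat \<times> ('m list \<times> nat \<times> 'c \<times> 'z) \<times> nat \<Rightarrow> 'x \<times> 'm list \<times> 'c list \<times> 'z list"
    and k :: nat
  defines "X \<equiv> hdom k :: ('m list \<times> nat \<times> 'c \<times> 'z) set"
  assumes delta_bound: "\<And>d' psi0' Us' meas'. valid_prover k l d' psi0' Us' \<Longrightarrow>
           ext_event_prob k l V Ext d' psi0' Us' meas'
             (\<lambda>(x, as, cs, zs) b w. as = a \<and> b \<and> bad_witness R x w) \<le> \<delta>"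
    and Us: "Us \<noteq> []" "\<And>U. U \<in> set Us \<Longrightarrow> unitary_on (pset d X l) U"
    and A: "A = region k a" and G: "G \<in> dbs (X - A) l"
    and t: "\<And>p D u. u \<in> A \<Longrightarrow> D u \<noteq> None \<Longrightarrow> t (p, D) = 0"
  shows "(\<Sum>p\<in>pset d X l. \<Sum>D\<in>dbs A l.
      (cmod (vf l (X - A) (snd (meas p)) k (\<lambda>D. grun (pset d X l) l (X - A) Us t (p, D)) (merge A D G)))\<^sup>2 *
      (if no_pair V a k (meas p) D then 1 else 0)) \<le> \<delta> * (\<Sum>p\<in>pset d X l. (cmod (t (p, G)))\<^sup>2)"
proof -
  let ?B = "pset d X l" and ?B' = "pset (d * 2 ^ l) X l"
  have AX: "A \<subseteq> X" by (simp add: A X_def region_subset)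
  have finX: "finite X" by (simp add: X_def)
  define m where "m = (\<Sum>p\<in>?B. (cmod (t (p, G)))\<^sup>2)"
  define W where "W p = (\<Sum>D\<in>dbs A l.
      (cmod (vf l (X - A) (snd (meas p)) k (\<lambda>D. grun ?B l (X - A) Us t (p, D)) (merge A D G)))\<^sup>2 *
      (if no_pair V a k (meas p) D then 1 else 0))" for p
  \<comment> \<open>Reading the output through \<open>swap_in\<close> undoes the swap at the end of
    the last operator, and the use of \<open>swap_out\<close> in \<open>psi\<close> cancels the one
    at the start of the first operator.\<close>
  define meas' where "meas' b = meas (ws l (swap_in l A b))" for b
  define psi where "psi c b = (if b \<in> ?B' then c * t (ws l (swap_out l A G b), G) else 0)" for c b
  define run where "run c = run_comp ?B' l (map (sim_U l A G) Us) (\<lambda>(p, D). psi c p * (if D = (\<lambda>_. None) then 1 else 0))" for c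
  define T where "T c = (\<Sum>b\<in>?B'. \<Sum>D\<in>dbs X l. (cmod (vf l {} (snd (meas' b)) k (\<lambda>D. run c (b, D)) D))\<^sup>2 *
     (if accept_ext k V (fst (meas' b)) (snd (meas' b)) (replicate k 0) \<and>
       fst (snd (meas' b)) = a \<and> bad_witness R (fst (meas' b)) (extractor_output V Ext (fst (meas' b)) D) then 1 else 0))" for c
  have sim: "simulates l d X A G c (swap_in l A) (run c) (grun ?B l (X - A) Us t)" for c
    unfolding run_def
  proof (rule simulates_run [OF finX AX G Us(1)])
    have "merge A (\<lambda>_. None) G = G"
      using G by (auto simp: merge_def dbs_def fun_eq_iff)
    \<comment> \<open>Emptiness at \<open>A\<close> enters here: the simulating prover starts from
      an empty database, so \<open>t\<close> has to vanish at every non-empty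
      \<open>D\<close>.\<close>
    moreover have "t (p, merge A D G) = 0" if "D \<in> dbs A l" "D \<noteq> (\<lambda>_. None)" for p D
    proof -
      obtain u where "D u \<noteq> None" using \<open>D \<noteq> (\<lambda>_. None)\<close> by (meson ext)
      moreover from this have "u \<in> A" using that(1) dbs_support by metis
      ultimately show ?thesis by (intro t [of u]) (auto simp: merge_def)
    qed
    ultimately show "simulates l d X A G c (swap_out l A G) (\<lambda>(p, D). psi c p * (if D = (\<lambda>_. None) then 1 else 0)) t"
      by (auto simp: simulates_def psi_def simp del: mem_Sigma_iff)
  qed
  \<comment> \<open>The factor \<open>2 ^ l\<close> counts the ancilla values above each original
    basis state. A database supported in \<open>A\<close> without a pair makes the extractor abort,
    which counts as a failure.\<close>
  have T_ge: "(cmod c)\<^sup>2 * (2 ^ l * (\<Sum>p\<in>?B. W p)) \<le> T c" for c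
  proof -
    have "(cmod c)\<^sup>2 * (2 ^ l * (\<Sum>p\<in>?B. W p)) = (\<Sum>b\<in>?B'. (cmod c)\<^sup>2 * W (ws l (swap_in l A b)))"
      unfolding sum_distrib_left [of "(cmod c)\<^sup>2", symmetric] trans [OF sum_swap_in sum_ws, of W] ..
    also have "\<dots> \<le> T c"
      unfolding T_def
    proof (rule sum_mono)
      fix b assume b: "b \<in> ?B'"
      let ?p = "ws l (swap_in l A b)"
      let ?v = "\<lambda>D. vf l (X - A) (snd (meas ?p)) k (\<lambda>D. grun ?B l (X - A) Us t (?p, D)) (merge A D G)"
      have *: "(cmod c)\<^sup>2 * ((cmod (?v D))\<^sup>2 * (if no_pair V a k (meas ?p) D then 1 else 0))
        \<le> (cmod (vf l {} (snd (meas' b)) k (\<lambda>D. run c (b, D)) D))\<^sup>2 *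
          (if accept_ext k V (fst (meas' b)) (snd (meas' b)) (replicate k 0) \<and>
           fst (snd (meas' b)) = a \<and> bad_witness R (fst (meas' b)) (extractor_output V Ext (fst (meas' b)) D) then 1 else 0)"
        if D: "D \<in> dbs A l" for D
      proof (cases "no_pair V a k (meas ?p) D")
        case True
        have DX: "D \<in> dbs X l" using D dbs_mono [OF AX] by blast
        have "vf l {} (snd (meas ?p)) k (\<lambda>D. run c (b, D)) D = (if D \<in> dbs A l then c * ?v D else 0)"
          by (rule vf_merge [OF AX _ DX])
             (use sim [of c] b no_pair_qpt [OF True] in \<open>auto simp: simulates_def A simp del: mem_Sigma_iff\<close>)
        moreover have "merge A D (\<lambda>_. None) = D"
          using D by (auto simp: merge_def dbs_def fun_eq_iff)
        ultimately show ?thesis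
          using True D by (simp add: no_pair_def meas'_def A extractor_output_def bad_witness_def
              norm_mult power_mult_distrib)
      qed simp
      have "(cmod c)\<^sup>2 * W ?p = (\<Sum>D\<in>dbs A l. (cmod c)\<^sup>2 * ((cmod (?v D))\<^sup>2 * (if no_pair V a k (meas ?p) D then 1 else 0)))"
        by (simp only: W_def sum_distrib_left)
      also have "\<dots> \<le> (\<Sum>D\<in>dbs A l. (cmod (vf l {} (snd (meas' b)) k (\<lambda>D. run c (b, D)) D))\<^sup>2 *
          (if accept_ext k V (fst (meas' b)) (snd (meas' b)) (replicate k 0) \<and>
           fst (snd (meas' b)) = a \<and> bad_witness R (fst (meas' b)) (extractor_output V Ext (fst (meas' b)) D) then 1 else 0))"
        by (rule sum_mono [OF *])
      also have "\<dots> \<le> (\<Sum>D\<in>dbs X l. (cmod (vf l {} (snd (meas' b)) k (\<lambda>D. run c (b, D)) D))\<^sup>2 *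
          (if accept_ext k V (fst (meas' b)) (snd (meas' b)) (replicate k 0) \<and>
           fst (snd (meas' b)) = a \<and> bad_witness R (fst (meas' b)) (extractor_output V Ext (fst (meas' b)) D) then 1 else 0))"
        using finX by (intro sum_mono2 dbs_mono AX) auto
      finally show "(cmod c)\<^sup>2 * W ?p \<le> \<dots>" .
    qed
    finally show ?thesis .
  qed
  have "(\<Sum>p\<in>?B. W p) \<le> \<delta> * m"
  \<comment> \<open>The zero state cannot be normalised to a valid prover, so it is treated
    separately.\<close>
  proof (cases "m = 0")
    case True
    then have "t (p, G) = 0" if "p \<in> ?B" for p
      using that finX by (auto simp: m_def sum_nonneg_eq_0_iff)
    then have "psi 1 b = 0" for b
      using pset_ws [OF pset_swap_out [OF _ G]] by (auto simp: psi_def simp del: mem_Sigma_iff)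
    then have "run 1 = run_comp ?B' l (map (sim_U l A G) Us) (\<lambda>_. 0)"
      unfolding run_def by (intro arg_cong [where f = "run_comp _ _ _"]) auto
    then have "run 1 = (\<lambda>_. 0)"
      by (simp only: run_comp_zero)
    then have "T 1 = 0"
      by (simp add: T_def vf_zero)
    with T_ge [of 1] have "2 ^ l * (\<Sum>p\<in>?B. W p) \<le> 2 ^ l * 0" by simp
    then have "(\<Sum>p\<in>?B. W p) \<le> 0" by (rule mult_left_le_imp_le) simp
    then show ?thesis using True by simp
  next
    case False
    then have m: "m > 0" by (simp add: m_def order.not_eq_order_implies_strict sum_nonneg)
    \<comment> \<open>This makes \<open>psi c\<close> a unit vector: without the factor its squared
      norm is \<open>2 ^ l * m\<close>, one copy of \<open>t\<close> at \<open>G\<close> per ancilla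
      value.\<close>
    define c where "c = complex_of_real (1 / sqrt (2 ^ l * m))"
    have c2: "(cmod c)\<^sup>2 = 1 / (2 ^ l * m)"
      unfolding c_def norm_of_real using m by (simp add: power_divide real_sqrt_pow2)
    have "(\<Sum>p\<in>?B'. (cmod (psi c p))\<^sup>2) = (\<Sum>b\<in>?B'. (\<lambda>b. (cmod c)\<^sup>2 * (cmod (t (ws l b, G)))\<^sup>2) (swap_out l A G b))"
      by (intro sum.cong refl) (simp add: psi_def norm_mult power_mult_distrib del: mem_Sigma_iff)
    also have "\<dots> = (\<Sum>b\<in>?B'. (cmod c)\<^sup>2 * (cmod (t (ws l b, G)))\<^sup>2)"
      by (rule sum_swap_out [OF finX G])
    also have "\<dots> = (cmod c)\<^sup>2 * (2 ^ l * m)"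
      unfolding m_def sum_ws [symmetric] by (simp only: sum_distrib_left)
    also have "\<dots> = 1" using m by (simp add: c2)
    finally have "valid_prover k l (d * 2 ^ l) (psi c) (map (sim_U l A G) Us)"
      using Us sim_U_unitary [OF finX G] by (auto simp: valid_prover_def pbasis_def X_def)
    from delta_bound [OF this, of meas'] have "T c \<le> \<delta>"
      by (subst (asm) sum_event_answers)
         (auto simp: T_def run_def pbasis_def db_basis_eq X_def case_prod_beta conj_commute conj_left_commute
           cong: sum.cong)
    with T_ge [of c] have "(\<Sum>p\<in>?B. W p) / m \<le> \<delta>"
      by (simp add: c2)
    then show ?thesis using m by (simp add: field_simps)
  qed
  then show ?thesis by (simp only: W_def m_def)
qed

text \<open>Keeping amplitudes instead of probabilities makes failure linear in the state, as the
  triangle inequality requires.\<close>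

definition fail_amp :: "nat \<Rightarrow> nat \<Rightarrow> ('x \<Rightarrow> 'm \<Rightarrow> 'c \<Rightarrow> 'z \<Rightarrow> bool) \<Rightarrow>
    ('p \<Rightarrow> 'x \<times> 'm list \<times> 'c list \<times> 'z list) \<Rightarrow> 'm list \<Rightarrow>
    ('p \<times> ('m list \<times> nat \<times> 'c \<times> 'z \<Rightarrow> nat option) \<Rightarrow> complex) \<Rightarrow>
    'p \<times> ('m list \<times> nat \<times> 'c \<times> 'z \<Rightarrow> nat option) \<Rightarrow> complex" where
  "fail_amp k l V meas a \<Psi> = (\<lambda>(p, D). if no_pair V a k (meas p) D
     then vf l {} (snd (meas p)) k (\<lambda>D. \<Psi> (p, D)) D else 0)"

lemma decomp_eq_0:
  assumes "\<And>D. P D \<Longrightarrow> F D = 0" "\<And>D u e. u \<in> set us \<Longrightarrow> P D \<Longrightarrow> P (D(u := e))" "P D"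
  shows "decomp l us F D = 0"
  using assms(2,3)
proof (induction us arbitrary: D)
  case (Cons u us)
  have "decomp l us F (D(u := e)) = 0" for e
    by (rule Cons.IH, rule Cons.prems(1), simp, assumption, rule Cons.prems(1), simp, rule Cons.prems(2))
  then show ?case by (simp add: decomp1_def)
qed (use assms(1) in simp)

text \<open>The event ignores the registers outside \<open>A\<close>, so decompressing them
  preserves its weight. Each resulting table \<open>G\<close> falls under
  \<open>simulated_failure_bound\<close>, and the bounds are summed over \<open>G\<close>.\<close>

lemma empty_failure_bound:
  fixes V :: "'x \<Rightarrow> 'm::{finite,linorder} \<Rightarrow> 'c::{finite,linorder} \<Rightarrow> 'z::{finite,linorder} \<Rightarrow> bool"
    and meas :: "nat \<times> ('m list \<times> nat \<times> 'c \<times> 'z) \<times> nat \<Rightarrow> 'x \<times> 'm list \<times> 'c list \<times> 'z list"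
    and k :: nat
  defines "X \<equiv> hdom k :: ('m list \<times> nat \<times> 'c \<times> 'z) set"
  assumes delta_bound: "\<And>d' psi0' Us' meas'. valid_prover k l d' psi0' Us' \<Longrightarrow>
           ext_event_prob k l V Ext d' psi0' Us' meas'
             (\<lambda>(x, as, cs, zs) b w. as = a \<and> b \<and> bad_witness R x w) \<le> \<delta>"
    and Us: "Us \<noteq> []" "\<And>U. U \<in> set Us \<Longrightarrow> unitary_on (pset d X l) U"
    and \<delta>: "0 \<le> \<delta>"
    and v: "\<And>p D u. u \<in> region k a \<Longrightarrow> D u \<noteq> None \<Longrightarrow> v (p, D) = 0"
  shows "nsq (pset d X l) (dbs X l) (fail_amp k l V meas a (run_comp (pset d X l) l Us v))
     \<le> \<delta> * nsq (pset d X l) (dbs X l) v"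
proof -
  let ?B = "pset d X l"
  define A :: "('m list \<times> nat \<times> 'c \<times> 'z) set" where "A = region k a"
  have AX: "A \<subseteq> X" by (simp add: A_def X_def region_subset)
  have finX: "finite X" by (simp add: X_def)
  obtain us where us: "set us = X - A" "distinct us"
    using finite_distinct_list [of "X - A"] finX by auto
  have usX: "set us \<subseteq> X" using us by auto
  define \<Psi> where "\<Psi> = run_comp ?B l Us v"
  define t where "t = dstate l us v"
  define g where "g p D = (if no_pair V a k (meas p) D then 1 else 0::real)" for p D
  have g_upd: "g p (D(u := e)) = g p D" if "u \<in> set us" for p D u e
  proof -
    have "merge A (D(u := e)) (\<lambda>_. None) = merge A D (\<lambda>_. None)"
      using that us by (auto simp: merge_def)
    then show ?thesis by (simp add: g_def no_pair_def A_def)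
  qed
  have g_merge: "g p (merge A D G) = g p D" for p D G
  proof -
    have "merge A (merge A D G) (\<lambda>_. None) = merge A D (\<lambda>_. None)"
      by (auto simp: merge_def)
    then show ?thesis by (simp add: g_def no_pair_def A_def)
  qed
  have t0: "t (p, D) = 0" if "u \<in> A" "D u \<noteq> None" for p D u
    unfolding t_def dstate_def split case_prod_conv
    by (rule decomp_eq_0 [where P = "\<lambda>D. D u \<noteq> None"]) (use that v us in \<open>auto simp: A_def\<close>)
  have "(\<Sum>D\<in>dbs X l. (cmod (fail_amp k l V meas a \<Psi> (p, D)))\<^sup>2)
     = (\<Sum>G\<in>dbs (X - A) l. \<Sum>D\<in>dbs A l.
      (cmod (vf l (X - A) (snd (meas p)) k (\<lambda>D. grun ?B l (X - A) Us t (p, D)) (merge A D G)))\<^sup>2 * g p D)"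
    if p: "p \<in> ?B" for p
  proof -
    have "(\<Sum>D\<in>dbs X l. (cmod (fail_amp k l V meas a \<Psi> (p, D)))\<^sup>2)
      = (\<Sum>D\<in>dbs X l. (cmod (vf l {} (snd (meas p)) k (\<lambda>D. \<Psi> (p, D)) D))\<^sup>2 * g p D)"
      by (intro sum.cong refl) (simp add: fail_amp_def g_def)
    also have "\<dots> = (\<Sum>D\<in>dbs X l. (cmod (decomp l us (vf l {} (snd (meas p)) k (\<lambda>D. \<Psi> (p, D))) D))\<^sup>2 * g p D)"
      by (rule decomp_isometry [OF usX g_upd, symmetric])
    also have "\<dots> = (\<Sum>D\<in>dbs X l. (cmod (vf l (X - A) (snd (meas p)) k (\<lambda>D. grun ?B l (X - A) Us t (p, D)) D))\<^sup>2 * g p D)"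
    proof (rule sum.cong [OF refl])
      fix D assume D: "D \<in> dbs X l"
      show "(cmod (decomp l us (vf l {} (snd (meas p)) k (\<lambda>D. \<Psi> (p, D))) D))\<^sup>2 * g p D
        = (cmod (vf l (X - A) (snd (meas p)) k (\<lambda>D. grun ?B l (X - A) Us t (p, D)) D))\<^sup>2 * g p D"
      proof (cases "no_pair V a k (meas p) D")
        case True
        have q: "qpt (snd (meas p)) j \<in> X" if "j < k" for j
          using no_pair_qpt [OF True that] AX A_def by blast
        have "decomp l us (vf l {} (snd (meas p)) k (\<lambda>D. \<Psi> (p, D))) D
          = vf l (X - A) (snd (meas p)) k (decomp l us (\<lambda>D. \<Psi> (p, D))) D"
          using decomp_vf [OF us(2) usX D q] by (simp add: us(1))
        also have "\<dots> = vf l (X - A) (snd (meas p)) k (\<lambda>D. grun ?B l (X - A) Us t (p, D)) D"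
        proof (rule vf_cong [OF _ D q])
          fix D assume "D \<in> dbs X l"
          from dstate_grun [OF this p us(2) usX, of Us v]
          show "decomp l us (\<lambda>D. \<Psi> (p, D)) D = grun ?B l (X - A) Us t (p, D)"
            by (simp add: \<Psi>_def run_comp_eq_grun t_def us(1)) (simp add: dstate_def)
        qed
        finally show ?thesis by simp
      qed (simp add: g_def)
    qed
    also have "\<dots> = (\<Sum>G\<in>dbs (X - A) l. \<Sum>D\<in>dbs A l.
      (cmod (vf l (X - A) (snd (meas p)) k (\<lambda>D. grun ?B l (X - A) Us t (p, D)) (merge A D G)))\<^sup>2 * g p (merge A D G))"
      by (rule sum_dbs_merge [OF AX])
    finally show ?thesis by (simp only: g_merge)
  qed
  then have "nsq ?B (dbs X l) (fail_amp k l V meas a \<Psi>) = (\<Sum>p\<in>?B. \<Sum>G\<in>dbs (X - A) l. \<Sum>D\<in>dbs A l.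
      (cmod (vf l (X - A) (snd (meas p)) k (\<lambda>D. grun ?B l (X - A) Us t (p, D)) (merge A D G)))\<^sup>2 * g p D)"
    unfolding nsq_def by (rule sum.cong [OF refl])
  also have "\<dots> = (\<Sum>G\<in>dbs (X - A) l. \<Sum>p\<in>?B. \<Sum>D\<in>dbs A l.
      (cmod (vf l (X - A) (snd (meas p)) k (\<lambda>D. grun ?B l (X - A) Us t (p, D)) (merge A D G)))\<^sup>2 * g p D)"
    by (rule sum.swap)
  also have "\<dots> \<le> (\<Sum>G\<in>dbs (X - A) l. \<delta> * (\<Sum>p\<in>?B. (cmod (t (p, G)))\<^sup>2))"
    unfolding g_def X_def
    by (rule sum_mono, rule simulated_failure_bound [where Ext = Ext and R = R and a = a and t = t],
        erule delta_bound, rule Us(1), erule Us(2) [unfolded X_def], rule A_def, assumption, erule t0, assumption)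
  also have "\<dots> = \<delta> * (\<Sum>p\<in>?B. \<Sum>G\<in>dbs (X - A) l. (cmod (t (p, G)))\<^sup>2)"
    unfolding sum_distrib_left [symmetric] by (subst sum.swap) simp
  \<comment> \<open>The tables \<open>G\<close> are the databases in \<open>dbs X l\<close> that are
    empty on \<open>A\<close>, so the sum over them is part of the full norm.\<close>
  also have "\<dots> \<le> \<delta> * nsq ?B (dbs X l) t"
    unfolding nsq_def using finX
    by (intro mult_left_mono [OF _ \<delta>] sum_mono sum_mono2 dbs_mono) auto
  also have "nsq ?B (dbs X l) t = nsq ?B (dbs X l) v"
    unfolding t_def by (rule nsq_dstate [OF usX])
  finally show ?thesis by (simp only: \<Psi>_def)
qed

section \<open>Telescoping over the queries\<close>

lemma sqrt_nsq: "sqrt (nsq B C f) = L2_set (\<lambda>x. cmod (f x)) (B \<times> C)"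
  by (simp add: nsq_def L2_set_def sum.cartesian_product case_prod_beta)

lemma sqrt_nsq_triangle:
  "sqrt (nsq B C (\<lambda>x. f x + c * g x)) \<le> sqrt (nsq B C f) + cmod c * sqrt (nsq B C g)"
proof -
  have "L2_set (\<lambda>x. cmod (f x + c * g x)) (B \<times> C) \<le> L2_set (\<lambda>x. cmod (f x) + cmod c * cmod (g x)) (B \<times> C)"
    by (intro L2_set_mono) (auto intro: order.trans [OF norm_triangle_ineq] simp: norm_mult)
  also have "\<dots> \<le> L2_set (\<lambda>x. cmod (f x)) (B \<times> C) + L2_set (\<lambda>x. cmod c * cmod (g x)) (B \<times> C)"
    by (rule L2_set_triangle_ineq)
  finally show ?thesis
    by (simp add: sqrt_nsq L2_set_right_distrib)
qed

lemma fail_amp_linear: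
  "fail_amp k l V meas a (\<lambda>x. f x + c * g x) = (\<lambda>x. fail_amp k l V meas a f x + c * fail_amp k l V meas a g x)"
  by (auto simp: fail_amp_def vf_linear)

lemma lift_U_linear: "lift_U B U (\<lambda>x. f x + c * g x) = (\<lambda>x. lift_U B U f x + c * lift_U B U g x)"
  by (auto simp: lift_U_def sum.distrib sum_distrib_left algebra_simps)

lemma cquery_linear: "cquery l (\<lambda>x. f x + c * g x) = (\<lambda>x. cquery l f x + c * cquery l g x)"
  by (auto simp: cquery_def sum.distrib sum_distrib_left algebra_simps)

lemma run_comp_linear:
  "run_comp B l Us (\<lambda>x. f x + c * g x) = (\<lambda>x. run_comp B l Us f x + c * run_comp B l Us g x)"
  by (induction Us arbitrary: f g rule: induct_list012) (simp_all add: lift_U_linear cquery_linear)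

definition unseen :: "nat \<Rightarrow> 'm list \<Rightarrow> ('m list \<times> nat \<times> 'c \<times> 'z \<Rightarrow> nat option) \<Rightarrow> bool" where
  "unseen k a D \<longleftrightarrow> (\<forall>u\<in>region k a. D u = None)"

definition empt :: "nat \<Rightarrow> 'm list \<Rightarrow> ('p \<times> ('m list \<times> nat \<times> 'c \<times> 'z \<Rightarrow> nat option) \<Rightarrow> complex) \<Rightarrow>
    'p \<times> ('m list \<times> nat \<times> 'c \<times> 'z \<Rightarrow> nat option) \<Rightarrow> complex" where
  "empt k a \<Psi> = (\<lambda>(p, D). if unseen k a D then \<Psi> (p, D) else 0)"

text \<open>\<open>empt\<close> is the projection \<open>E\<^sub>a\<close>; here it is combined with
  the projection on register label \<open>a\<close>. The label is the commitment vector either of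
  the query input, giving \<open>\<Pi>\<^sub>a E\<^sub>a\<close>, or of the output proof.\<close>

definition lab_empt :: "nat \<Rightarrow> ('p \<Rightarrow> 'm list) \<Rightarrow> 'm list \<Rightarrow>
    ('p \<times> ('m list \<times> nat \<times> 'c \<times> 'z \<Rightarrow> nat option) \<Rightarrow> complex) \<Rightarrow>
    'p \<times> ('m list \<times> nat \<times> 'c \<times> 'z \<Rightarrow> nat option) \<Rightarrow> complex" where
  "lab_empt k lab a \<Psi> = (\<lambda>(p, D). if lab p = a then empt k a \<Psi> (p, D) else 0)"

lemma lift_U_empt: "lift_U B U (empt k a \<Psi>) = empt k a (lift_U B U \<Psi>)"
  by (auto simp: lift_U_def empt_def fun_eq_iff)

text \<open>On query inputs containing \<open>a\<close> the last two terms cancel. On all others the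
  labelled terms vanish, and the query commutes with the projection because it does not touch the
  entries at \<open>a\<close>. The factors \<open>1\<close> and \<open>-1\<close> fit the shape of
  the linearity lemmas.\<close>

lemma cquery_empt:
  fixes \<Psi> :: "(nat \<times> ('m list \<times> nat \<times> 'c \<times> 'z) \<times> nat) \<times> ('m list \<times> nat \<times> 'c \<times> 'z \<Rightarrow> nat option) \<Rightarrow> complex"
  defines "qlab \<equiv> (\<lambda>(w, u, y). fst u)"
  shows "cquery l (empt k a \<Psi>) = (\<lambda>x. (cquery l (lab_empt k qlab a \<Psi>) x + 1 * empt k a (cquery l \<Psi>) x)
      + (-1) * lab_empt k qlab a (cquery l \<Psi>) x)"
proof
  fix x :: "(nat \<times> ('m list \<times> nat \<times> 'c \<times> 'z) \<times> nat) \<times> ('m list \<times> nat \<times> 'c \<times> 'z \<Rightarrow> nat option)"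
  obtain w u y' D where x: "x = ((w, u, y'), D)" by (cases x) auto
  show "cquery l (empt k a \<Psi>) x = (cquery l (lab_empt k qlab a \<Psi>) x + 1 * empt k a (cquery l \<Psi>) x)
      + (-1) * lab_empt k qlab a (cquery l \<Psi>) x"
  proof (cases "fst u = a")
    case True
    then show ?thesis by (simp add: x cquery_def lab_empt_def qlab_def)
  next
    case False
    then have "u \<notin> region k a"
      by (simp add: region_def)
    then have "unseen k a (D(u := e)) \<longleftrightarrow> unseen k a D" for e
      unfolding unseen_def by (intro ball_cong refl) (metis fun_upd_other)
    then show ?thesis using False
      by (simp add: x cquery_def lab_empt_def qlab_def empt_def)
  qed
qed

text \<open>A run starts with a unitary, whereas a term of the telescope may start with a query; a
  leading identity turns it into a run.\<close>

definition id_mat :: "'b \<Rightarrow> 'b \<Rightarrow> complex" where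
  "id_mat a b = (if a = b then 1 else 0)"

lemma id_mat_unitary: "finite B \<Longrightarrow> unitary_on B id_mat"
  by (auto simp: unitary_on_def id_mat_def if_distrib [of cnj] if_distrib [of "\<lambda>x. x * _"] cong: if_cong)

lemma lift_U_id_mat: "finite B \<Longrightarrow> p \<in> B \<Longrightarrow> lift_U B id_mat \<Psi> (p, D) = \<Psi> (p, D)"
  by (simp add: lift_U_def id_mat_def if_distrib [of "\<lambda>x. x * _"] cong: if_cong)

text \<open>\<open>fail_amp\<close> vanishes on outputs with other commitment vectors, so a
  projection on the output label \<open>a\<close> can be inserted at the end of a run.\<close>

lemma nsq_fail_amp_cong:
  fixes meas :: "'p \<Rightarrow> 'x \<times> 'm list \<times> 'c list \<times> 'z list"
  assumes "\<And>p D. p \<in> B \<Longrightarrow> fst (snd (meas p)) = a \<Longrightarrow> D \<in> dbs (hdom k) l \<Longrightarrow> f (p, D) = g (p, D)"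
  shows "nsq B (dbs (hdom k) l) (fail_amp k l V meas a f) = nsq B (dbs (hdom k) l) (fail_amp k l V meas a g)"
  unfolding nsq_def
proof (intro sum.cong refl)
  fix p D assume pD: "p \<in> B" "D \<in> dbs (hdom k :: ('m list \<times> nat \<times> 'c \<times> 'z) set) l"
  show "(cmod (fail_amp k l V meas a f (p, D)))\<^sup>2 = (cmod (fail_amp k l V meas a g (p, D)))\<^sup>2"
  proof (cases "no_pair V a k (meas p) D")
    case True
    then have "fst (snd (meas p)) = a" by (simp add: no_pair_def)
    moreover have "qpt (snd (meas p)) j \<in> hdom k" if "j < k" for j
      using no_pair_qpt [OF True that] region_subset by blast
    ultimately have "vf l {} (snd (meas p)) k (\<lambda>D. f (p, D)) D = vf l {} (snd (meas p)) k (\<lambda>D. g (p, D)) D"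
      using assms pD by (intro vf_cong [of "hdom k"]) auto
    then show ?thesis by (simp add: fail_amp_def)
  qed (simp add: fail_amp_def)
qed

text \<open>Every basis state has a single label, so the projections for different \<open>a\<close>
  have orthogonal ranges.\<close>

lemma sum_nsq_lab_empt:
  assumes "finite L"
  shows "(\<Sum>a\<in>L. nsq B C (lab_empt k lab a \<Psi>)) \<le> nsq B C \<Psi>"
proof -
  have "(\<Sum>a\<in>L. nsq B C (lab_empt k lab a \<Psi>)) = (\<Sum>p\<in>B. \<Sum>D\<in>C. \<Sum>a\<in>L. (cmod (lab_empt k lab a \<Psi> (p, D)))\<^sup>2)"
    unfolding nsq_def by (subst sum.swap, rule sum.cong [OF refl], rule sum.swap)
  also have "\<dots> \<le> nsq B C \<Psi>"
    unfolding nsq_def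
  proof (intro sum_mono)
    fix p D
    have "(\<Sum>a\<in>L. (cmod (lab_empt k lab a \<Psi> (p, D)))\<^sup>2) \<le> (\<Sum>a\<in>L. if a = lab p then (cmod (\<Psi> (p, D)))\<^sup>2 else 0)"
      by (intro sum_mono) (auto simp: lab_empt_def empt_def)
    also have "\<dots> \<le> (cmod (\<Psi> (p, D)))\<^sup>2"
      using assms by simp
    finally show "(\<Sum>a\<in>L. (cmod (lab_empt k lab a \<Psi> (p, D)))\<^sup>2) \<le> (cmod (\<Psi> (p, D)))\<^sup>2" .
  qed
  finally show ?thesis .
qed

lemma extract_pairs_merge: "extract_pairs V x (merge A D (\<lambda>_. None)) \<subseteq> extract_pairs V x D"
  by (auto simp: extract_pairs_def merge_def split: if_splits)

lemma finite_lists_len: "finite {a :: 'm::finite list. length a = k}"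
  using finite_lists_length_eq [of "UNIV :: 'm set" k] by simp

section \<open>The triangle inequality over the commitment vectors\<close>

context
  fixes V :: "'x \<Rightarrow> 'm::{finite,linorder} \<Rightarrow> 'c::{finite,linorder} \<Rightarrow> 'z::{finite,linorder} \<Rightarrow> bool"
    and Ext :: "'x \<Rightarrow> 'm \<Rightarrow> 'c \<Rightarrow> 'c \<Rightarrow> 'z \<Rightarrow> 'z \<Rightarrow> 'w"
    and R :: "('x \<times> 'w) set"
    and meas :: "nat \<times> ('m list \<times> nat \<times> 'c \<times> 'z) \<times> nat \<Rightarrow> 'x \<times> 'm list \<times> 'c list \<times> 'z list"
    and k l d :: nat and \<delta> :: real
  assumes delta_nonneg: "0 \<le> \<delta>"
    and delta_bound: "\<And>d' psi0' Us' meas' a0. valid_prover k l d' psi0' Us' \<Longrightarrow> length a0 = k \<Longrightarrow>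
           ext_event_prob k l V Ext d' psi0' Us' meas'
             (\<lambda>(x, as, cs, zs) b w. as = a0 \<and> b \<and> bad_witness R x w) \<le> \<delta>"
begin

abbreviation (input) "fnorm a \<Psi> \<equiv>
  sqrt (nsq (pset d (hdom k) l) (dbs (hdom k) l) (fail_amp k l V meas a \<Psi>))"

abbreviation (input) "cvecs \<equiv> {a :: 'm list. length a = k}"

text \<open>Orthogonality of the labels is what avoids a factor for the number of commitment
  vectors.\<close>

lemma labelled_failure_bound:
  assumes "Us \<noteq> []" "\<And>U. U \<in> set Us \<Longrightarrow> unitary_on (pset d (hdom k) l) U"
  shows "L2_set (\<lambda>a. fnorm a (run_comp (pset d (hdom k) l) l Us (lab_empt k lab a \<Psi>))) cvecs
     \<le> sqrt \<delta> * sqrt (nsq (pset d (hdom k) l) (dbs (hdom k) l) \<Psi>)"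
proof -
  let ?B = "pset d (hdom k :: ('m list \<times> nat \<times> 'c \<times> 'z) set) l" and ?D = "dbs (hdom k :: ('m list \<times> nat \<times> 'c \<times> 'z) set) l"
  have "(\<Sum>a\<in>cvecs. nsq ?B ?D (fail_amp k l V meas a (run_comp ?B l Us (lab_empt k lab a \<Psi>))))
     \<le> (\<Sum>a\<in>cvecs. \<delta> * nsq ?B ?D (lab_empt k lab a \<Psi>))"
  proof (rule sum_mono)
    fix a assume "a \<in> cvecs"
    then show "nsq ?B ?D (fail_amp k l V meas a (run_comp ?B l Us (lab_empt k lab a \<Psi>)))
      \<le> \<delta> * nsq ?B ?D (lab_empt k lab a \<Psi>)"
      by (intro empty_failure_bound [where Ext = Ext and R = R] delta_bound assms delta_nonneg)
         (auto simp: lab_empt_def empt_def unseen_def)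
  qed
  also have "\<dots> \<le> \<delta> * nsq ?B ?D \<Psi>"
    unfolding sum_distrib_left [symmetric]
    by (intro mult_left_mono sum_nsq_lab_empt finite_lists_len delta_nonneg)
  finally show ?thesis
    unfolding real_sqrt_mult [symmetric] L2_set_def by (intro real_sqrt_le_mono) simp
qed

text \<open>The factor counts terms: one for the end of the run and two for each of the
  \<open>length Us - 1\<close> queries. The remaining term, in which the projection has moved past
  the query, goes to the induction hypothesis.\<close>

lemma empt_failure_bound:
  assumes "Us \<noteq> []" "\<And>U. U \<in> set Us \<Longrightarrow> unitary_on (pset d (hdom k) l) U"
  shows "L2_set (\<lambda>a. fnorm a (run_comp (pset d (hdom k) l) l Us (empt k a \<Psi>))) cvecs
     \<le> (2 * real (length Us) - 1) * (sqrt \<delta> * sqrt (nsq (pset d (hdom k) l) (dbs (hdom k) l) \<Psi>))"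
  using assms
proof (induction Us arbitrary: \<Psi> rule: induct_list012)
  case 1
  then show ?case by simp
next
  let ?B = "pset d (hdom k :: ('m list \<times> nat \<times> 'c \<times> 'z) set) l"
  have fin: "finite ?B" by simp
  case (2 U)
  \<comment> \<open>With no query left, the commitment vector of the output proof serves as label;
    inserting its projection does not affect failure.\<close>
  let ?\<Phi> = "lift_U ?B U \<Psi>" and ?lab = "\<lambda>p. fst (snd (meas p))"
  have "fnorm a (run_comp ?B l [U] (empt k a \<Psi>)) = fnorm a (run_comp ?B l [id_mat] (lab_empt k ?lab a ?\<Phi>))" for a
    by (subst nsq_fail_amp_cong [where g = "run_comp ?B l [id_mat] (lab_empt k ?lab a ?\<Phi>)"])
       (simp_all add: lift_U_empt lift_U_id_mat [OF fin] lab_empt_def del: mem_Sigma_iff)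
  moreover have "L2_set (\<lambda>a. fnorm a (run_comp ?B l [id_mat] (lab_empt k ?lab a ?\<Phi>))) cvecs
      \<le> sqrt \<delta> * sqrt (nsq ?B (dbs (hdom k) l) ?\<Phi>)"
    by (rule labelled_failure_bound) (simp_all add: id_mat_unitary [OF fin])
  moreover have "nsq ?B (dbs (hdom k) l) ?\<Phi> = nsq ?B (dbs (hdom k) l) \<Psi>"
    using 2 by (intro nsq_lift_U fin) simp
  ultimately show ?case by simp
next
  let ?B = "pset d (hdom k :: ('m list \<times> nat \<times> 'c \<times> 'z) set) l" and ?D = "dbs (hdom k :: ('m list \<times> nat \<times> 'c \<times> 'z) set) l"
  have fin: "finite ?B" by simp
  case (3 U U' Us)
  let ?\<Phi> = "lift_U ?B U \<Psi>" and ?Us = "U' # Us"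
  define qlab where "qlab = (\<lambda>(w::nat, u::'m list \<times> nat \<times> 'c \<times> 'z, y::nat). fst u)"
  define \<beta> where "\<beta> = sqrt \<delta> * sqrt (nsq ?B ?D \<Psi>)"
  have n1: "nsq ?B ?D ?\<Phi> = nsq ?B ?D \<Psi>"
    using 3 by (intro nsq_lift_U fin) simp
  have n2: "nsq ?B ?D (cquery l ?\<Phi>) = nsq ?B ?D \<Psi>"
    unfolding n1 [symmetric] by (rule nsq_cquery [OF finite_hdom])
  \<comment> \<open>The three terms of \<open>cquery_empt\<close>: \<open>f1\<close> is projected
    before the query, \<open>f3\<close> after it, and \<open>f2\<close> continues the
    induction.\<close>
  define f1 f2 f3 where "f1 a = fnorm a (run_comp ?B l (id_mat # ?Us) (lab_empt k qlab a ?\<Phi>))"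
    and "f2 a = fnorm a (run_comp ?B l ?Us (empt k a (cquery l ?\<Phi>)))"
    and "f3 a = fnorm a (run_comp ?B l ?Us (lab_empt k qlab a (cquery l ?\<Phi>)))" for a
  have step: "fnorm a (run_comp ?B l (U # ?Us) (empt k a \<Psi>)) \<le> (f1 a + f2 a) + f3 a" for a
  proof -
    let ?g1 = "run_comp ?B l ?Us (cquery l (lab_empt k qlab a ?\<Phi>))"
    let ?g2 = "run_comp ?B l ?Us (empt k a (cquery l ?\<Phi>))"
    let ?g3 = "run_comp ?B l ?Us (lab_empt k qlab a (cquery l ?\<Phi>))"
    have "run_comp ?B l (U # ?Us) (empt k a \<Psi>) = (\<lambda>x. (?g1 x + 1 * ?g2 x) + (-1) * ?g3 x)"
      by (simp only: run_comp.simps lift_U_empt cquery_empt qlab_def [symmetric] run_comp_linear)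
    then have "fnorm a (run_comp ?B l (U # ?Us) (empt k a \<Psi>)) \<le> fnorm a (\<lambda>x. ?g1 x + 1 * ?g2 x) + cmod (-1) * fnorm a ?g3"
      by (simp only: fail_amp_linear sqrt_nsq_triangle)
    also have "\<dots> \<le> (fnorm a ?g1 + cmod 1 * fnorm a ?g2) + cmod (-1) * fnorm a ?g3"
      by (intro add_right_mono) (simp only: fail_amp_linear sqrt_nsq_triangle)
    also have "fnorm a ?g1 = f1 a"
      unfolding f1_def run_comp.simps
    proof (rule arg_cong [where f = sqrt], rule nsq_fail_amp_cong)
      fix p D assume "p \<in> ?B" "D \<in> ?D"
      then show "?g1 (p, D) = run_comp ?B l ?Us (cquery l (lift_U ?B id_mat (lab_empt k qlab a ?\<Phi>))) (p, D)"
        unfolding run_comp_eq_grun cquery_eq_genquery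
        by (intro grun_cong genquery_cong [of d "hdom k"] lift_U_id_mat [OF fin, symmetric])
    qed
    finally show ?thesis by (simp add: f2_def f3_def)
  qed
  have b1: "L2_set f1 cvecs \<le> \<beta>"
    unfolding f1_def \<beta>_def n1 [symmetric]
    by (rule labelled_failure_bound) (use 3(4) id_mat_unitary [OF fin] in auto)
  have b2: "L2_set f2 cvecs \<le> (2 * real (length ?Us) - 1) * \<beta>"
    unfolding f2_def \<beta>_def n2 [symmetric]
    by (rule 3(2)) (use 3(4) in auto)
  have b3: "L2_set f3 cvecs \<le> \<beta>"
    unfolding f3_def \<beta>_def n2 [symmetric]
    by (rule labelled_failure_bound) (use 3(4) in auto)
  have "L2_set (\<lambda>a. fnorm a (run_comp ?B l (U # ?Us) (empt k a \<Psi>))) cvecs \<le> L2_set (\<lambda>a. (f1 a + f2 a) + f3 a) cvecs"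
    by (intro L2_set_mono step) simp
  also have "\<dots> \<le> (L2_set f1 cvecs + L2_set f2 cvecs) + L2_set f3 cvecs"
    by (rule order.trans [OF L2_set_triangle_ineq add_right_mono [OF L2_set_triangle_ineq]])
  also have "\<dots> \<le> (\<beta> + (2 * real (length ?Us) - 1) * \<beta>) + \<beta>"
    by (intro add_mono b1 b2 b3)
  also have "\<dots> = (2 * real (length (U # ?Us)) - 1) * \<beta>"
    by (simp add: algebra_simps)
  finally show ?case by (simp only: \<beta>_def)
qed

end

text \<open>Every accepting failure is charged to the commitment vector of its own output proof,
  which leaves the squared \<open>L2_set\<close> norm bounded by
  \<open>empt_failure_bound\<close>.\<close>

lemma extraction_error_bound:
  fixes V :: "'x \<Rightarrow> 'm::{finite,linorder} \<Rightarrow> 'c::{finite,linorder} \<Rightarrow> 'z::{finite,linorder} \<Rightarrow> bool"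
  assumes special_soundness: "\<And>x a c c' z z'. c \<noteq> c' \<Longrightarrow> V x a c z \<Longrightarrow> V x a c' z' \<Longrightarrow> (x, Ext x a c c' z z') \<in> R"
    and unique_responses: "\<And>x a c z z'. z \<noteq> z' \<Longrightarrow> \<not> (V x a c z \<and> V x a c z')"
    and prover: "valid_prover k l d psi0 Us"
    and delta_nonneg: "0 \<le> \<delta>"
    and delta_bound: "\<And>d' psi0' Us' meas' a0. valid_prover k l d' psi0' Us' \<Longrightarrow> length a0 = k \<Longrightarrow>
           ext_event_prob k l V Ext d' psi0' Us' meas'
             (\<lambda>(x, as, cs, zs) b w. as = a0 \<and> b \<and> bad_witness R x w) \<le> \<delta>"
  shows "ext_event_prob k l V Ext d psi0 Us meas (\<lambda>(x, \<pi>) b w. b \<and> bad_witness R x w)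
     \<le> (2 * real (length Us) - 1)\<^sup>2 * \<delta>"
proof -
  let ?X = "hdom k :: ('m list \<times> nat \<times> 'c \<times> 'z) set"
  let ?B = "pset d ?X l"
  let ?L = "{a :: 'm list. length a = k}"
  define \<Psi>0 where "\<Psi>0 = (\<lambda>(p :: nat \<times> ('m list \<times> nat \<times> 'c \<times> 'z) \<times> nat, D :: 'm list \<times> nat \<times> 'c \<times> 'z \<Rightarrow> nat option). psi0 p * (if D = (\<lambda>_. None) then 1 else 0))"
  define \<Psi> where "\<Psi> = run_comp ?B l Us \<Psi>0"
  have emp: "empt k a \<Psi>0 = \<Psi>0" for a
    by (auto simp: empt_def unseen_def \<Psi>0_def)
  have "nsq ?B (dbs ?X l) \<Psi>0 = (\<Sum>p\<in>?B. \<Sum>D\<in>dbs ?X l. if D = (\<lambda>_. None) then (cmod (psi0 p))\<^sup>2 else 0)"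
    unfolding nsq_def by (intro sum.cong refl) (auto simp: \<Psi>0_def)
  also have "\<dots> = 1"
    using prover by (simp add: valid_prover_def pbasis_def)
  finally have n0: "nsq ?B (dbs ?X l) \<Psi>0 = 1" .
  have Us: "Us \<noteq> []" "\<And>U. U \<in> set Us \<Longrightarrow> unitary_on ?B U"
    using prover by (auto simp: valid_prover_def pbasis_def)
  have "L2_set (\<lambda>a. sqrt (nsq ?B (dbs ?X l) (fail_amp k l V meas a \<Psi>))) ?L \<le> (2 * real (length Us) - 1) * sqrt \<delta>"
    using empt_failure_bound [OF delta_nonneg delta_bound Us, of meas \<Psi>0] by (simp add: emp n0 \<Psi>_def)
  then have "(L2_set (\<lambda>a. sqrt (nsq ?B (dbs ?X l) (fail_amp k l V meas a \<Psi>))) ?L)\<^sup>2 \<le> ((2 * real (length Us) - 1) * sqrt \<delta>)\<^sup>2"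
    by (rule power_mono) simp
  then have main: "(\<Sum>a\<in>?L. nsq ?B (dbs ?X l) (fail_amp k l V meas a \<Psi>)) \<le> (2 * real (length Us) - 1)\<^sup>2 * \<delta>"
    using delta_nonneg by (simp add: L2_set_def sum_nonneg power_mult_distrib)
  have "ext_event_prob k l V Ext d psi0 Us meas (\<lambda>(x, \<pi>) b w. b \<and> bad_witness R x w)
    = (\<Sum>p\<in>?B. \<Sum>D\<in>dbs ?X l. (cmod (vf l {} (snd (meas p)) k (\<lambda>D. \<Psi> (p, D)) D))\<^sup>2 *
         (if accept_ext k V (fst (meas p)) (snd (meas p)) (replicate k 0) \<and>
             bad_witness R (fst (meas p)) (extractor_output V Ext (fst (meas p)) D) then 1 else 0))"
    by (subst sum_event_answers)
       (auto simp: \<Psi>_def \<Psi>0_def pbasis_def db_basis_eq case_prod_beta cong: sum.cong)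
  also have "\<dots> \<le> (\<Sum>p\<in>?B. \<Sum>D\<in>dbs ?X l. \<Sum>a\<in>?L. (cmod (fail_amp k l V meas a \<Psi> (p, D)))\<^sup>2)"
  proof (intro sum_mono)
    fix p D assume D: "D \<in> dbs ?X l"
    show "(cmod (vf l {} (snd (meas p)) k (\<lambda>D. \<Psi> (p, D)) D))\<^sup>2 *
         (if accept_ext k V (fst (meas p)) (snd (meas p)) (replicate k 0) \<and>
             bad_witness R (fst (meas p)) (extractor_output V Ext (fst (meas p)) D) then 1 else 0)
       \<le> (\<Sum>a\<in>?L. (cmod (fail_amp k l V meas a \<Psi> (p, D)))\<^sup>2)" (is "?l \<le> ?r")
    proof (cases "accept_ext k V (fst (meas p)) (snd (meas p)) (replicate k 0) \<and>
             bad_witness R (fst (meas p)) (extractor_output V Ext (fst (meas p)) D)")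
      case True
      let ?a = "fst (snd (meas p))"
      have "{u. D u \<noteq> None} \<subseteq> ?X"
        using dbs_support [OF D] by blast
      then have "finite {u. D u \<noteq> None}"
        by (rule finite_subset) simp
      with True have "extract_pairs V (fst (meas p)) D = {}"
        by (intro bad_witness_no_pair [where Ext = Ext and R = R] special_soundness unique_responses) auto
      then have "extract_pairs V (fst (meas p)) (merge (region k ?a) D (\<lambda>_. None)) = {}"
        using extract_pairs_merge [of V "fst (meas p)" "region k ?a" D] by blast
      with True have "no_pair V ?a k (meas p) D"
        by (simp add: no_pair_def)
      then have "?l = (cmod (fail_amp k l V meas ?a \<Psi> (p, D)))\<^sup>2"
        using True by (simp add: fail_amp_def)
      also have "\<dots> \<le> ?r"
        using True
        by (intro member_le_sum) (auto simp: finite_lists_len accept_ext_def wf_proof_def split: prod.splits)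
      finally show ?thesis .
    qed (auto simp: sum_nonneg)
  qed
  also have "\<dots> = (\<Sum>a\<in>?L. nsq ?B (dbs ?X l) (fail_amp k l V meas a \<Psi>))"
    unfolding nsq_def by (subst sum.swap, rule sum.cong [OF refl], rule sum.swap) 
  finally show ?thesis using main by simp
qed

theorem theorem2:
  fixes R :: "('x \<times> 'w) set"
    and V\<^sub>\<Sigma> :: "'x \<Rightarrow> 'm::{finite,linorder} \<Rightarrow> 'c::{finite,linorder} \<Rightarrow> 'z::{finite,linorder} \<Rightarrow> bool"
    and P1 :: "'x \<Rightarrow> 'w \<Rightarrow> 'r \<Rightarrow> 'm"
    and P2 :: "'x \<Rightarrow> 'w \<Rightarrow> 'r \<Rightarrow> 'c \<Rightarrow> 'z"
    and Ext\<^sub>s\<^sub>s :: "'x \<Rightarrow> 'm \<Rightarrow> 'c \<Rightarrow> 'c \<Rightarrow> 'z \<Rightarrow> 'z \<Rightarrow> 'w"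
    and k l q d :: nat
    and psi0 :: "nat \<times> ('m list \<times> nat \<times> 'c \<times> 'z) \<times> nat \<Rightarrow> complex"
    and Us :: "(nat \<times> ('m list \<times> nat \<times> 'c \<times> 'z) \<times> nat \<Rightarrow> nat \<times> ('m list \<times> nat \<times> 'c \<times> 'z) \<times> nat \<Rightarrow> complex) list"
    and meas :: "nat \<times> ('m list \<times> nat \<times> 'c \<times> 'z) \<times> nat \<Rightarrow> 'x \<times> 'm list \<times> 'c list \<times> 'z list"
    and \<delta> :: real
  assumes completeness: "\<And>x w r c. (x, w) \<in> R \<Longrightarrow> V\<^sub>\<Sigma> x (P1 x w r) c (P2 x w r c)"
    and special_soundness: "\<And>x a c c' z z'. c \<noteq> c' \<Longrightarrow> V\<^sub>\<Sigma> x a c z \<Longrightarrow> V\<^sub>\<Sigma> x a c' z' \<Longrightarrow>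
           (x, Ext\<^sub>s\<^sub>s x a c c' z z') \<in> R"
    and unique_responses: "\<And>x a c z z'. z \<noteq> z' \<Longrightarrow> \<not> (V\<^sub>\<Sigma> x a c z \<and> V\<^sub>\<Sigma> x a c z')"
    and k_pos: "0 < k"
    and prover: "valid_prover k l d psi0 Us"
    and queries: "length Us \<le> Suc q"
    and delta_nonneg: "0 \<le> \<delta>"
    and delta_bound: "\<And>d' psi0' Us' meas' a0. valid_prover k l d' psi0' Us' \<Longrightarrow> length a0 = k \<Longrightarrow>
           ext_event_prob k l V\<^sub>\<Sigma> Ext\<^sub>s\<^sub>s d' psi0' Us' meas'
             (\<lambda>(x, as, cs, zs) b w. as = a0 \<and> b \<and> bad_witness R x w) \<le> \<delta>"
  shows "ext_event_prob k l V\<^sub>\<Sigma> Ext\<^sub>s\<^sub>s d psi0 Us meas (\<lambda>_ b _. b)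
           = std_accept_prob k l V\<^sub>\<Sigma> d psi0 Us meas \<and>
         ext_event_prob k l V\<^sub>\<Sigma> Ext\<^sub>s\<^sub>s d psi0 Us meas (\<lambda>(x, \<pi>) b w. b \<and> bad_witness R x w)
           \<le> 4 * (real q + real k)\<^sup>2 * \<delta>"
proof
  show "ext_event_prob k l V\<^sub>\<Sigma> Ext\<^sub>s\<^sub>s d psi0 Us meas (\<lambda>_ b _. b) = std_accept_prob k l V\<^sub>\<Sigma> d psi0 Us meas"
    by (rule ext_accept_prob_eq_std)
  have "ext_event_prob k l V\<^sub>\<Sigma> Ext\<^sub>s\<^sub>s d psi0 Us meas (\<lambda>(x, \<pi>) b w. b \<and> bad_witness R x w)
      \<le> (2 * real (length Us) - 1)\<^sup>2 * \<delta>"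
    by (rule extraction_error_bound [OF special_soundness unique_responses prover delta_nonneg delta_bound])
  also have "\<dots> \<le> (2 * (real q + real k))\<^sup>2 * \<delta>"
  proof (intro mult_right_mono power_mono delta_nonneg)
    have "length Us \<ge> 1" using prover by (cases Us) (auto simp: valid_prover_def)
    then show "0 \<le> 2 * real (length Us) - 1" by linarith
    \<comment> \<open>At most \<open>q\<close> queries mean \<open>length Us \<le> q + 1\<close>, so
      the left side is at most \<open>2 * q + 1\<close>; the missing unit is supplied by
      \<open>k \<ge> 1\<close>.\<close>
    show "2 * real (length Us) - 1 \<le> 2 * (real q + real k)"
      using of_nat_mono [OF queries, where 'a = real] k_pos by simp
  qed
  finally show "ext_event_prob k l V\<^sub>\<Sigma> Ext\<^sub>s\<^sub>s d psi0 Us meas (\<lambda>(x, \<pi>) b w. b \<and> bad_witness R x w)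
      \<le> 4 * (real q + real k)\<^sup>2 * \<delta>"
    unfolding power_mult_distrib by simp
qed

end
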